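(* $\mathrm{FO}^2(\Sigma,<,+1,\sim,+^c1)$ and unary-DLTL are equivalent over data words and over data $\omega$-words. More precisely: (1) for every unary-DLTL formula $\varphi$ there is an $\mathrm{FO}^2(\Sigma,<,+1,\sim,+^c1)$ formula $\varphi'(x)$ such that for every data word (or data $\omega$-word) $w$ and position $i$, $w,i\models\varphi$ iff $w\models\varphi'(x)$ with $x$ interpreted as $i$; moreover the size of $\varphi'(x)$ is linear in the size of $\varphi$, and the quantifier depth of $\varphi'(x)$ equals the modal depth of $\varphi$; (2) for every $\mathrm{FO}^2(\Sigma,<,+1,\sim,+^c1)$ formula $\varphi(x)$ there is a unary-DLTL formula $\varphi'$ such that $w,i\models\varphi'$ iff $w\models\varphi(x)$ with $x$ interpreted as $i$; the size of $\varphi'$ is (at most) exponential in the size of $\varphi(x)$, and the modal depth of $\varphi'$ is linear in the quantifier depth of $\varphi(x)$.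
   Context: Data words / data $\omega$-words: finite / infinite sequences $(a_1,d_1)(a_2,d_2)\cdots$ over $\Sigma\times\mathcal D$ ($\Sigma$ finite, $\mathcal D$ infinite), positions $1,2,\dots$; $i\sim j$ iff $d_i=d_j$; the class successor $i+^c1$ of $i$ is the least $j>i$ with $j\sim i$ (if any); the class predecessor is the greatest $j<i$ with $j\sim i$. $\mathrm{FO}^2(\Sigma,<,+1,\sim,+^c1)$: first-order logic over positions using only two variables $x,y$ (reusable), with unary predicates $a(x)$ for $a\in\Sigma$ (position labelled $a$) and binary predicates $x=y$, $x<y$, $x+1=y$, $x\sim y$, $x+^c1=y$ ($y$ is the class successor of $x$). Quantifier depth: maximal nesting of quantifiers. Unary-DLTL: formulas $\varphi::= a\ (a\in\Sigma)\mid \mathsf S\mid\mathsf P\mid \mathsf M\varphi\mid\varphi\wedge\varphi\mid\neg\varphi$ with $\mathsf M\in\{\mathtt X^g,\mathtt Y^g,\mathtt X^c,\mathtt Y^c,\mathtt F^g,\mathtt P^g,\mathtt F^c,\mathtt P^c\}$, evaluated at positions $i$ of $w$: $a$ holds iff $a_i=a$; $\mathsf S$ holds iff $i$ is not last and $i+1$ is the class successor of $i$; $\mathsf P$ holds iff $i\ne1$ and $i-1$ is the class predecessor of $i$; $\mathtt X^g\varphi$, $\mathtt Y^g\varphi$, $\mathtt X^c\varphi$, $\mathtt Y^c\varphi$ hold iff the successor, predecessor, class successor, class predecessor of $i$ exists and satisfies $\varphi$; $\mathtt F^g\varphi$ ($\mathtt P^g\varphi$) iff some $j\ge i$ ($j\le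 i$) satisfies $\varphi$; $\mathtt F^c\varphi$ ($\mathtt P^c\varphi$) iff some $j\ge i$ ($j\le i$) with $j\sim i$ satisfies $\varphi$. Modal depth: maximal nesting of the unary modalities.
   Formalization: S and P are counted as contributing 1 to the modal depth; if they had depth 0, "quantifier depth equals modal depth" would fail for φ = S, since a quantifier-free formula in x sees only the label of x and cannot separate the two positions of (a,d)(a,d). *)

theory Defs
  imports Main
begin

section \<open>Data words and data \<open>\<omega>\<close>-words\<close>

datatype ('a, 'd) data_word =
    Finite_Word "('a \<times> 'd) list"
  | Omega_Word "nat \<Rightarrow> 'a \<times> 'd"

text \<open>Positions are counted from 1, whereas lists and functions are indexed from 0.\<close>

fun positions :: "('a, 'd) data_word \<Rightarrow> nat set" where
  "positions (Finite_Word xs) = {1..length xs}"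
| "positions (Omega_Word f) = {1..}"

fun entry :: "('a, 'd) data_word \<Rightarrow> nat \<Rightarrow> 'a \<times> 'd" where
  "entry (Finite_Word xs) i = xs ! (i - 1)"
| "entry (Omega_Word f) i = f (i - 1)"

definition label :: "('a, 'd) data_word \<Rightarrow> nat \<Rightarrow> 'a" where
  "label w i = fst (entry w i)"

definition datum :: "('a, 'd) data_word \<Rightarrow> nat \<Rightarrow> 'd" where
  "datum w i = snd (entry w i)"

definition same_class :: "('a, 'd) data_word \<Rightarrow> nat \<Rightarrow> nat \<Rightarrow> bool" where
  "same_class w i j \<longleftrightarrow> datum w i = datum w j"

definition is_class_succ :: "('a, 'd) data_word \<Rightarrow> nat \<Rightarrow> nat \<Rightarrow> bool" where
  "is_class_succ w i j \<longleftrightarrow>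
     j \<in> positions w \<and> i < j \<and> same_class w j i \<and>
     (\<forall>k\<in>positions w. i < k \<and> same_class w k i \<longrightarrow> j \<le> k)"

definition is_class_pred :: "('a, 'd) data_word \<Rightarrow> nat \<Rightarrow> nat \<Rightarrow> bool" where
  "is_class_pred w i j \<longleftrightarrow>
     j \<in> positions w \<and> j < i \<and> same_class w j i \<and>
     (\<forall>k\<in>positions w. k < i \<and> same_class w k i \<longrightarrow> k \<le> j)"


section \<open>Two-variable first-order logic\<close>

datatype var = VX | VY

datatype 'a fo2 =
    FLabel 'a var
  | FEq var var
  | FLess var var
  | FSucc var var
  | FSim var var
  | FClassSucc var var
  | FNot "'a fo2"
  | FAnd "'a fo2" "'a fo2"
  | FOr "'a fo2" "'a fo2"
  | FEx var "'a fo2"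
  | FAll var "'a fo2"

fun fo2_sat :: "('a, 'd) data_word \<Rightarrow> (var \<Rightarrow> nat) \<Rightarrow> 'a fo2 \<Rightarrow> bool" where
  "fo2_sat w \<sigma> (FLabel a u) \<longleftrightarrow> label w (\<sigma> u) = a"
| "fo2_sat w \<sigma> (FEq u v) \<longleftrightarrow> \<sigma> u = \<sigma> v"
| "fo2_sat w \<sigma> (FLess u v) \<longleftrightarrow> \<sigma> u < \<sigma> v"
| "fo2_sat w \<sigma> (FSucc u v) \<longleftrightarrow> \<sigma> u + 1 = \<sigma> v"
| "fo2_sat w \<sigma> (FSim u v) \<longleftrightarrow> same_class w (\<sigma> u) (\<sigma> v)"
| "fo2_sat w \<sigma> (FClassSucc u v) \<longleftrightarrow> is_class_succ w (\<sigma> u) (\<sigma> v)"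
| "fo2_sat w \<sigma> (FNot \<phi>) \<longleftrightarrow> \<not> fo2_sat w \<sigma> \<phi>"
| "fo2_sat w \<sigma> (FAnd \<phi> \<psi>) \<longleftrightarrow> fo2_sat w \<sigma> \<phi> \<and> fo2_sat w \<sigma> \<psi>"
| "fo2_sat w \<sigma> (FOr \<phi> \<psi>) \<longleftrightarrow> fo2_sat w \<sigma> \<phi> \<or> fo2_sat w \<sigma> \<psi>"
| "fo2_sat w \<sigma> (FEx u \<phi>) \<longleftrightarrow> (\<exists>p\<in>positions w. fo2_sat w (\<sigma>(u := p)) \<phi>)"
| "fo2_sat w \<sigma> (FAll u \<phi>) \<longleftrightarrow> (\<forall>p\<in>positions w. fo2_sat w (\<sigma>(u := p)) \<phi>)"

fun free_vars :: "'a fo2 \<Rightarrow> var set" where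
  "free_vars (FLabel a u) = {u}"
| "free_vars (FEq u v) = {u, v}"
| "free_vars (FLess u v) = {u, v}"
| "free_vars (FSucc u v) = {u, v}"
| "free_vars (FSim u v) = {u, v}"
| "free_vars (FClassSucc u v) = {u, v}"
| "free_vars (FNot \<phi>) = free_vars \<phi>"
| "free_vars (FAnd \<phi> \<psi>) = free_vars \<phi> \<union> free_vars \<psi>"
| "free_vars (FOr \<phi> \<psi>) = free_vars \<phi> \<union> free_vars \<psi>"
| "free_vars (FEx u \<phi>) = free_vars \<phi> - {u}"
| "free_vars (FAll u \<phi>) = free_vars \<phi> - {u}"

fun fo2_size :: "'a fo2 \<Rightarrow> nat" where
  "fo2_size (FNot \<phi>) = 1 + fo2_size \<phi>"
| "fo2_size (FAnd \<phi> \<psi>) = 1 + fo2_size \<phi> + fo2_size \<psi>"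
| "fo2_size (FOr \<phi> \<psi>) = 1 + fo2_size \<phi> + fo2_size \<psi>"
| "fo2_size (FEx u \<phi>) = 1 + fo2_size \<phi>"
| "fo2_size (FAll u \<phi>) = 1 + fo2_size \<phi>"
| "fo2_size _ = 1"

fun quantifier_depth :: "'a fo2 \<Rightarrow> nat" where
  "quantifier_depth (FNot \<phi>) = quantifier_depth \<phi>"
| "quantifier_depth (FAnd \<phi> \<psi>) = max (quantifier_depth \<phi>) (quantifier_depth \<psi>)"
| "quantifier_depth (FOr \<phi> \<psi>) = max (quantifier_depth \<phi>) (quantifier_depth \<psi>)"
| "quantifier_depth (FEx u \<phi>) = 1 + quantifier_depth \<phi>"
| "quantifier_depth (FAll u \<phi>) = 1 + quantifier_depth \<phi>"
| "quantifier_depth _ = 0"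


section \<open>Unary-DLTL\<close>

datatype modality = Xg | Yg | Xc | Yc | Fg | Pg | Fc | Pc

datatype 'a dltl =
    DLabel 'a
  | DS
  | DP
  | DModal modality "'a dltl"
  | DAnd "'a dltl" "'a dltl"
  | DNot "'a dltl"

fun accessible :: "('a, 'd) data_word \<Rightarrow> modality \<Rightarrow> nat \<Rightarrow> nat \<Rightarrow> bool" where
  "accessible w Xg i j \<longleftrightarrow> j = i + 1"
| "accessible w Yg i j \<longleftrightarrow> j + 1 = i"
| "accessible w Xc i j \<longleftrightarrow> is_class_succ w i j"
| "accessible w Yc i j \<longleftrightarrow> is_class_pred w i j"
| "accessible w Fg i j \<longleftrightarrow> j \<ge> i"
| "accessible w Pg i j \<longleftrightarrow> j \<le> i"
| "accessible w Fc i j \<longleftrightarrow> j \<ge> i \<and> same_class w j i"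
| "accessible w Pc i j \<longleftrightarrow> j \<le> i \<and> same_class w j i"

text \<open>
  In the clauses for \<open>DS\<close> and \<open>DP\<close> the existence of the position next to \<open>i\<close> is part of
  \<open>is_class_succ\<close> and \<open>is_class_pred\<close>, which place it in \<open>positions w\<close>; in particular
  \<open>DP\<close> is false at position 1, since 0 is not a position.
\<close>

fun dltl_sat :: "('a, 'd) data_word \<Rightarrow> nat \<Rightarrow> 'a dltl \<Rightarrow> bool" where
  "dltl_sat w i (DLabel a) \<longleftrightarrow> label w i = a"
| "dltl_sat w i DS \<longleftrightarrow> is_class_succ w i (i + 1)"
| "dltl_sat w i DP \<longleftrightarrow> is_class_pred w i (i - 1)"
| "dltl_sat w i (DModal m \<phi>) \<longleftrightarrow> (\<exists>j\<in>positions w. accessible w m i j \<and> dltl_sat w j \<phi>)"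
| "dltl_sat w i (DAnd \<phi> \<psi>) \<longleftrightarrow> dltl_sat w i \<phi> \<and> dltl_sat w i \<psi>"
| "dltl_sat w i (DNot \<phi>) \<longleftrightarrow> \<not> dltl_sat w i \<phi>"

fun dltl_size :: "'a dltl \<Rightarrow> nat" where
  "dltl_size (DModal m \<phi>) = 1 + dltl_size \<phi>"
| "dltl_size (DAnd \<phi> \<psi>) = 1 + dltl_size \<phi> + dltl_size \<psi>"
| "dltl_size (DNot \<phi>) = 1 + dltl_size \<phi>"
| "dltl_size _ = 1"

text \<open>
  \<open>DS\<close> and \<open>DP\<close> inspect a neighbouring position and count as modalities without argument,
  contributing one level of nesting. With depth 0 they would have no first-order counterpart
  of equal quantifier depth: a quantifier-free formula whose only variable is \<open>x\<close> depends
  on the label of \<open>x\<close> alone.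
\<close>

fun modal_depth :: "'a dltl \<Rightarrow> nat" where
  "modal_depth (DLabel a) = 0"
| "modal_depth DS = 1"
| "modal_depth DP = 1"
| "modal_depth (DModal m \<phi>) = 1 + modal_depth \<phi>"
| "modal_depth (DAnd \<phi> \<psi>) = max (modal_depth \<phi>) (modal_depth \<psi>)"
| "modal_depth (DNot \<phi>) = modal_depth \<phi>"

end

theory Submission
  imports Defs
begin

text \<open>
  From DLTL to first-order logic, each modality becomes one quantifier, the two variables
  alternating.

  Conversely, the relations between two positions \<open>x\<close> and \<open>y\<close> split into eleven mutually
  exclusive types. By structural induction every formula becomes a disjunction of triples
  \<open>A(x) \<and> (type of (x, y) \<in> R) \<and> B(y)\<close> with \<open>A\<close>, \<open>B\<close> in DLTL. Positive and negated formulas are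
  normalised simultaneously, so the total weight of the triples is at most multiplied by
  conjunction and disjunction, which yields a single exponential. An existential quantifier
  is eliminated by expressing, for each type, that some position of this type
  satisfies \<open>B\<close>.

  Only the type ``in another class and not adjacent'' is delicate. If a set of positions has at
  most one element in each class, then it meets a class other than that of \<open>x\<close> iff it is
  nonempty and either has two elements or misses the class of \<open>x\<close>; unary modalities can say
  this. The last \<open>B\<close>-positions of the classes form such a set. Classes with infinitely
  many \<open>B\<close>-positions have no last one, but they are represented by their first one.
\<close>

section \<open>From unary-DLTL to two-variable logic\<close>

fun other :: "var \<Rightarrow> var" where
  "other VX = VY"
| "other VY = VX"

lemma other_neq [simp]: "other u \<noteq> u" "u \<noteq> other u"
  by (cases u; simp)+

text \<open>Quantifier-free, so that a modality costs exactly one quantifier. \<open>Fg\<close>,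
  \<open>Pg\<close>, \<open>Fc\<close> and \<open>Pc\<close> are reflexive, hence the negated
  \<open>FLess\<close> with reversed arguments.\<close>

fun access_formula :: "modality \<Rightarrow> var \<Rightarrow> var \<Rightarrow> 'a fo2" where
  "access_formula Xg u v = FSucc u v"
| "access_formula Yg u v = FSucc v u"
| "access_formula Xc u v = FClassSucc u v"
| "access_formula Yc u v = FClassSucc v u"
| "access_formula Fg u v = FNot (FLess v u)"
| "access_formula Pg u v = FNot (FLess u v)"
| "access_formula Fc u v = FAnd (FNot (FLess v u)) (FSim v u)"
| "access_formula Pc u v = FAnd (FNot (FLess u v)) (FSim v u)"

fun to_fo2 :: "var \<Rightarrow> 'a dltl \<Rightarrow> 'a fo2" where
  "to_fo2 u (DLabel a) = FLabel a u"
| "to_fo2 u DS = FEx (other u) (FAnd (FSucc u (other u)) (FClassSucc u (other u)))"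
| "to_fo2 u DP = FEx (other u) (FAnd (FSucc (other u) u) (FClassSucc (other u) u))"
| "to_fo2 u (DModal m \<phi>) =
     FEx (other u) (FAnd (access_formula m u (other u)) (to_fo2 (other u) \<phi>))"
| "to_fo2 u (DAnd \<phi> \<psi>) = FAnd (to_fo2 u \<phi>) (to_fo2 u \<psi>)"
| "to_fo2 u (DNot \<phi>) = FNot (to_fo2 u \<phi>)"

lemma zero_notin_positions [simp]: "0 \<notin> positions w"
  by (cases w) auto

lemma positions_convex:
  "\<lbrakk>i \<in> positions w; j \<in> positions w; i \<le> k; k \<le> j\<rbrakk> \<Longrightarrow> k \<in> positions w"
  by (cases w) auto

text \<open>Both sides say that \<open>j\<close> precedes \<open>i\<close> in one class with no
  member of the class strictly between. Each definition makes only its last argument a position,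
  whence the two hypotheses.\<close>

lemma class_succ_iff_class_pred:
  "\<lbrakk>i \<in> positions w; j \<in> positions w\<rbrakk> \<Longrightarrow> is_class_succ w j i \<longleftrightarrow> is_class_pred w i j"
  unfolding is_class_succ_def is_class_pred_def same_class_def
  by (metis leD leI)

lemma access_formula_sat:
  assumes "\<sigma> u \<in> positions w" "\<sigma> v \<in> positions w"
  shows "fo2_sat w \<sigma> (access_formula m u v) \<longleftrightarrow> accessible w m (\<sigma> u) (\<sigma> v)"
  using assms by (cases m) (auto simp: class_succ_iff_class_pred)

lemma to_fo2_sat:
  "\<sigma> u \<in> positions w \<Longrightarrow> fo2_sat w \<sigma> (to_fo2 u \<phi>) \<longleftrightarrow> dltl_sat w (\<sigma> u) \<phi>"
proof (induction \<phi> arbitrary: u \<sigma>)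
  case DS
  then show ?case by (auto simp: is_class_succ_def)
next
  case DP
  have "is_class_pred w (\<sigma> u) (\<sigma> u - 1) \<longleftrightarrow>
    (\<exists>p\<in>positions w. Suc p = \<sigma> u \<and> is_class_succ w p (\<sigma> u))"
  proof
    assume *: "is_class_pred w (\<sigma> u) (\<sigma> u - 1)"
    \<comment> \<open>Truncated subtraction does no harm: 0 is not a position, so
      \<open>\<sigma> u - 1\<close> is a genuine predecessor.\<close>
    then have "\<sigma> u - 1 \<in> positions w" "\<sigma> u \<noteq> 0"
      by (auto simp: is_class_pred_def)
    with * DP show "\<exists>p\<in>positions w. Suc p = \<sigma> u \<and> is_class_succ w p (\<sigma> u)"
      by (intro bexI[of _ "\<sigma> u - 1"]) (auto simp: class_succ_iff_class_pred)
  next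
    assume "\<exists>p\<in>positions w. Suc p = \<sigma> u \<and> is_class_succ w p (\<sigma> u)"
    with DP show "is_class_pred w (\<sigma> u) (\<sigma> u - 1)"
      by (metis class_succ_iff_class_pred diff_Suc_1)
  qed
  then show ?case by auto
next
  case (DModal m \<phi>)
  then show ?case by (auto simp: access_formula_sat)
qed auto

lemma free_vars_access_formula: "free_vars (access_formula m u v) \<subseteq> {u, v}"
  by (cases m) auto

lemma free_vars_to_fo2: "free_vars (to_fo2 u \<phi>) \<subseteq> {u}"
proof (induction \<phi> arbitrary: u)
  case (DModal m \<phi>)
  then show ?case using free_vars_access_formula[of m u "other u"] by fastforce
qed auto

lemma fo2_size_access_formula: "fo2_size (access_formula m u v) \<le> 4"
  by (cases m) auto

text \<open>The worst case is \<open>Fc\<close> or \<open>Pc\<close>: one quantifier, one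
  conjunction and an access formula of size 4.\<close>

lemma fo2_size_to_fo2: "fo2_size (to_fo2 u \<phi>) \<le> 6 * dltl_size \<phi>"
proof (induction \<phi> arbitrary: u)
  case (DModal m \<phi>)
  show ?case
    using DModal[of "other u"] fo2_size_access_formula[of m u "other u", where 'a='a] by simp
next
  case (DAnd \<phi> \<psi>)
  show ?case using DAnd.IH(1)[of u] DAnd.IH(2)[of u] by simp
next
  case (DNot \<phi>)
  show ?case using DNot[of u] by simp
qed auto

lemma quantifier_depth_access_formula [simp]: "quantifier_depth (access_formula m u v) = 0"
  by (cases m) auto

lemma quantifier_depth_to_fo2: "quantifier_depth (to_fo2 u \<phi>) = modal_depth \<phi>"
  by (induction \<phi> arbitrary: u) auto


section \<open>Derived DLTL operators\<close>

text \<open>The syntax has no truth constants; \<open>undefined\<close> stands for an arbitrary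
  letter.\<close>

definition dfalse :: "'a dltl" where
  "dfalse = DAnd (DLabel undefined) (DNot (DLabel undefined))"

definition dtrue :: "'a dltl" where
  "dtrue = DNot dfalse"

definition dor :: "'a dltl \<Rightarrow> 'a dltl \<Rightarrow> 'a dltl" where
  "dor \<phi> \<psi> = DNot (DAnd (DNot \<phi>) (DNot \<psi>))"

definition disj :: "'a dltl list \<Rightarrow> 'a dltl" where
  "disj \<phi>s = foldr dor \<phi>s dfalse"

lemma dltl_sat_dfalse [simp]: "\<not> dltl_sat w i dfalse"
  by (simp add: dfalse_def)

lemma dltl_sat_dtrue [simp]: "dltl_sat w i dtrue"
  by (simp add: dtrue_def)

lemma dltl_sat_dor [simp]: "dltl_sat w i (dor \<phi> \<psi>) \<longleftrightarrow> dltl_sat w i \<phi> \<or> dltl_sat w i \<psi>"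
  by (simp add: dor_def)

lemma dltl_sat_disj [simp]: "dltl_sat w i (disj \<phi>s) \<longleftrightarrow> (\<exists>\<phi>\<in>set \<phi>s. dltl_sat w i \<phi>)"
  by (induction \<phi>s) (auto simp: disj_def)

lemma dltl_size_dfalse [simp]: "dltl_size dfalse = 4"
  by (simp add: dfalse_def)

lemma dltl_size_dtrue [simp]: "dltl_size dtrue = 5"
  by (simp add: dtrue_def)

lemma dltl_size_dor [simp]: "dltl_size (dor \<phi> \<psi>) = dltl_size \<phi> + dltl_size \<psi> + 4"
  by (simp add: dor_def)

lemma dltl_size_disj: "dltl_size (disj \<phi>s) = 4 + (\<Sum>\<phi>\<leftarrow>\<phi>s. dltl_size \<phi> + 4)"
  by (induction \<phi>s) (auto simp: disj_def)

lemma modal_depth_dfalse [simp]: "modal_depth dfalse = 0"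
  by (simp add: dfalse_def)

lemma modal_depth_dtrue [simp]: "modal_depth dtrue = 0"
  by (simp add: dtrue_def)

lemma modal_depth_dor [simp]: "modal_depth (dor \<phi> \<psi>) = max (modal_depth \<phi>) (modal_depth \<psi>)"
  by (simp add: dor_def)

lemma modal_depth_disj_le: "(\<And>\<phi>. \<phi> \<in> set \<phi>s \<Longrightarrow> modal_depth \<phi> \<le> n) \<Longrightarrow> modal_depth (disj \<phi>s) \<le> n"
  by (induction \<phi>s) (auto simp: disj_def)

section \<open>Future and past treated uniformly\<close>

datatype dir = Future | Past

fun opposite :: "dir \<Rightarrow> dir" where
  "opposite Future = Past"
| "opposite Past = Future"

fun ahead :: "dir \<Rightarrow> nat \<Rightarrow> nat \<Rightarrow> bool" where
  "ahead Future i j \<longleftrightarrow> i < j"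
| "ahead Past i j \<longleftrightarrow> j < i"

fun adjacent :: "dir \<Rightarrow> nat \<Rightarrow> nat \<Rightarrow> bool" where
  "adjacent Future i j \<longleftrightarrow> j = i + 1"
| "adjacent Past i j \<longleftrightarrow> j + 1 = i"

fun class_next :: "('a, 'd) data_word \<Rightarrow> dir \<Rightarrow> nat \<Rightarrow> nat \<Rightarrow> bool" where
  "class_next w Future i j \<longleftrightarrow> is_class_succ w i j"
| "class_next w Past i j \<longleftrightarrow> is_class_pred w i j"

fun next_same :: "dir \<Rightarrow> 'a dltl" where
  "next_same Future = DS"
| "next_same Past = DP"

definition gnext :: "dir \<Rightarrow> 'a dltl \<Rightarrow> 'a dltl" where
  "gnext d = DModal (case d of Future \<Rightarrow> Xg | Past \<Rightarrow> Yg)"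

definition cnext :: "dir \<Rightarrow> 'a dltl \<Rightarrow> 'a dltl" where
  "cnext d = DModal (case d of Future \<Rightarrow> Xc | Past \<Rightarrow> Yc)"

text \<open>One step ahead turns the reflexive modality into a strict one, at the price of a second
  modal level.\<close>

definition gstrict :: "dir \<Rightarrow> 'a dltl \<Rightarrow> 'a dltl" where
  "gstrict d \<phi> = gnext d (DModal (case d of Future \<Rightarrow> Fg | Past \<Rightarrow> Pg) \<phi>)"

definition cstrict :: "dir \<Rightarrow> 'a dltl \<Rightarrow> 'a dltl" where
  "cstrict d \<phi> = cnext d (DModal (case d of Future \<Rightarrow> Fc | Past \<Rightarrow> Pc) \<phi>)"

lemma opposite_opposite [simp]: "opposite (opposite d) = d"
  by (cases d) auto

lemma ahead_linear: "i = j \<or> ahead d i j \<or> ahead d j i"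
  by (cases d) auto

lemma ahead_irrefl [simp]: "\<not> ahead d i i"
  by (cases d) auto

lemma ahead_trans: "ahead d i j \<Longrightarrow> ahead d j k \<Longrightarrow> ahead d i k"
  by (cases d) auto

lemma adjacent_ahead: "adjacent d i j \<Longrightarrow> ahead d i j"
  by (cases d) auto

lemma adjacent_unique: "adjacent d i j \<Longrightarrow> adjacent d i k \<Longrightarrow> j = k"
  by (cases d) auto

lemma adjacent_least: "adjacent d i j \<Longrightarrow> ahead d i k \<Longrightarrow> k = j \<or> ahead d j k"
  by (cases d) auto

text \<open>Positions form an interval, so a position ahead of \<open>i\<close> forces the neighbour
  on that side to exist.\<close>

lemma adjacent_exists:
  assumes "i \<in> positions w" "k \<in> positions w" "ahead d i k"
  shows "\<exists>j\<in>positions w. adjacent d i j"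
proof (cases d)
  case Future
  then show ?thesis using assms positions_convex[of i w k "i + 1"] by auto
next
  case Past
  then show ?thesis using assms positions_convex[of k w i "i - 1"]
    by (intro bexI[of _ "i - 1"]) auto
qed

lemma same_class_refl [simp]: "same_class w i i"
  by (simp add: same_class_def)

lemma same_class_sym: "same_class w i j \<longleftrightarrow> same_class w j i"
  by (auto simp: same_class_def)

lemma same_class_trans: "same_class w i j \<Longrightarrow> same_class w j k \<Longrightarrow> same_class w i k"
  by (simp add: same_class_def)

lemma class_next_iff:
  "class_next w d i j \<longleftrightarrow> j \<in> positions w \<and> ahead d i j \<and> same_class w j i \<and>
     (\<forall>k\<in>positions w. ahead d i k \<and> same_class w k i \<longrightarrow> k = j \<or> ahead d j k)"
  by (cases d) (auto simp: is_class_succ_def is_class_pred_def order.order_iff_strict)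

lemma class_next_exists:
  assumes "k \<in> positions w" "ahead d i k" "same_class w k i"
  shows "\<exists>j. class_next w d i j"
proof (cases d)
  case Future
  let ?P = "\<lambda>j. j \<in> positions w \<and> i < j \<and> same_class w j i"
  have "?P k" using assms Future by simp
  then have "?P (LEAST j. ?P j)" by (rule LeastI)
  moreover have "(LEAST j. ?P j) \<le> j" if "?P j" for j using that by (rule Least_le)
  ultimately have "class_next w d i (LEAST j. ?P j)"
    unfolding Future class_next.simps is_class_succ_def by blast
  then show ?thesis ..
next
  case Past
  let ?P = "\<lambda>j. j \<in> positions w \<and> j < i \<and> same_class w j i"
  have k: "?P k" using assms Past by simp
  \<comment> \<open>The candidates are bounded by \<open>i\<close>, so a greatest one
    exists.\<close>
  have "?P (GREATEST j. ?P j)" by (rule GreatestI_nat[where P = ?P, OF k, of i]) simp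
  moreover have "j \<le> (GREATEST j. ?P j)" if "?P j" for j
    by (rule Greatest_le_nat[where P = ?P, OF that, of i]) simp
  ultimately have "class_next w d i (GREATEST j. ?P j)"
    unfolding Past class_next.simps is_class_pred_def by blast
  then show ?thesis ..
qed

lemma dltl_sat_gnext:
  "dltl_sat w i (gnext d \<phi>) \<longleftrightarrow> (\<exists>j\<in>positions w. adjacent d i j \<and> dltl_sat w j \<phi>)"
  by (cases d) (auto simp: gnext_def)

lemma dltl_sat_cnext:
  "dltl_sat w i (cnext d \<phi>) \<longleftrightarrow> (\<exists>j\<in>positions w. class_next w d i j \<and> dltl_sat w j \<phi>)"
  by (cases d) (auto simp: cnext_def)

text \<open>Nothing lies between a position and its neighbour, so a neighbour of the same class is
  automatically next in the class.\<close>

lemma dltl_sat_next_same: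
  assumes "i \<in> positions w"
  shows "dltl_sat w i (next_same d) \<longleftrightarrow> (\<exists>j\<in>positions w. adjacent d i j \<and> same_class w j i)"
proof (cases d)
  case Future
  then show ?thesis by (auto simp: is_class_succ_def)
next
  case Past
  have "i \<noteq> 0" using assms by (cases i) auto
  then obtain k where "i = Suc k" by (cases i) auto
  then show ?thesis using Past by (auto simp: is_class_pred_def)
qed

text \<open>Whatever is ahead of \<open>i\<close> is its neighbour or ahead of that neighbour;
  exchanging the two existential quantifiers gives the claim.\<close>

lemma dltl_sat_gstrict:
  assumes "i \<in> positions w"
  shows "dltl_sat w i (gstrict d \<phi>) \<longleftrightarrow> (\<exists>j\<in>positions w. ahead d i j \<and> dltl_sat w j \<phi>)"
proof -
  have "dltl_sat w i (gstrict d \<phi>) \<longleftrightarrow>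
    (\<exists>j\<in>positions w. adjacent d i j \<and> (\<exists>k\<in>positions w. (k = j \<or> ahead d j k) \<and> dltl_sat w k \<phi>))"
    unfolding gstrict_def dltl_sat_gnext by (cases d) (auto simp: order.order_iff_strict)
  moreover have "(\<exists>j\<in>positions w. adjacent d i j \<and> (k = j \<or> ahead d j k)) \<longleftrightarrow> ahead d i k"
    if k: "k \<in> positions w" for k
  proof
    assume "\<exists>j\<in>positions w. adjacent d i j \<and> (k = j \<or> ahead d j k)"
    then obtain j where "adjacent d i j" "k = j \<or> ahead d j k" by blast
    then show "ahead d i k" using adjacent_ahead[of d i j] ahead_trans[of d i j k] by auto
  next
    assume "ahead d i k"
    then show "\<exists>j\<in>positions w. adjacent d i j \<and> (k = j \<or> ahead d j k)"
      using adjacent_exists[OF assms k] adjacent_least[of d i _ k] by blast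
  qed
  ultimately show ?thesis by blast
qed

text \<open>As for \<open>gstrict\<close>, with the next position of the class in place of the
  neighbour.\<close>

lemma dltl_sat_cstrict:
  "dltl_sat w i (cstrict d \<phi>) \<longleftrightarrow>
     (\<exists>j\<in>positions w. ahead d i j \<and> same_class w j i \<and> dltl_sat w j \<phi>)"
proof -
  have "dltl_sat w i (cstrict d \<phi>) \<longleftrightarrow> (\<exists>j\<in>positions w. class_next w d i j \<and>
      (\<exists>k\<in>positions w. (k = j \<or> ahead d j k) \<and> same_class w k j \<and> dltl_sat w k \<phi>))"
    unfolding cstrict_def dltl_sat_cnext by (cases d) (auto simp: order.order_iff_strict)
  moreover have "(\<exists>j\<in>positions w. class_next w d i j \<and> (k = j \<or> ahead d j k) \<and> same_class w k j) \<longleftrightarrow>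
    ahead d i k \<and> same_class w k i" if k: "k \<in> positions w" for k
  proof
    assume "\<exists>j\<in>positions w. class_next w d i j \<and> (k = j \<or> ahead d j k) \<and> same_class w k j"
    then obtain j where "ahead d i j" "same_class w j i" "k = j \<or> ahead d j k" "same_class w k j"
      unfolding class_next_iff by blast
    then show "ahead d i k \<and> same_class w k i"
      using ahead_trans[of d i j k] same_class_trans[of w k j i] by auto
  next
    assume *: "ahead d i k \<and> same_class w k i"
    then obtain j where j: "class_next w d i j" using class_next_exists[OF k] by blast
    then have "j \<in> positions w" "same_class w j i" "k = j \<or> ahead d j k"
      using * k unfolding class_next_iff by auto
    moreover have "same_class w k j"
      using * \<open>same_class w j i\<close> by (simp add: same_class_def)
    ultimately show
      "\<exists>j\<in>positions w. class_next w d i j \<and> (k = j \<or> ahead d j k) \<and> same_class w k j"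
      using j by blast
  qed
  ultimately show ?thesis by blast
qed

lemma dltl_size_next_same [simp]: "dltl_size (next_same d) = 1"
  by (cases d) auto

lemma dltl_size_gnext [simp]: "dltl_size (gnext d \<phi>) = 1 + dltl_size \<phi>"
  by (simp add: gnext_def)

lemma dltl_size_cnext [simp]: "dltl_size (cnext d \<phi>) = 1 + dltl_size \<phi>"
  by (simp add: cnext_def)

lemma dltl_size_gstrict [simp]: "dltl_size (gstrict d \<phi>) = 2 + dltl_size \<phi>"
  by (simp add: gstrict_def)

lemma dltl_size_cstrict [simp]: "dltl_size (cstrict d \<phi>) = 2 + dltl_size \<phi>"
  by (simp add: cstrict_def)

lemma modal_depth_next_same [simp]: "modal_depth (next_same d) = 1"
  by (cases d) auto

lemma modal_depth_gnext [simp]: "modal_depth (gnext d \<phi>) = 1 + modal_depth \<phi>"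
  by (simp add: gnext_def)

lemma modal_depth_cnext [simp]: "modal_depth (cnext d \<phi>) = 1 + modal_depth \<phi>"
  by (simp add: cnext_def)

lemma modal_depth_gstrict [simp]: "modal_depth (gstrict d \<phi>) = 2 + modal_depth \<phi>"
  by (simp add: gstrict_def)

lemma modal_depth_cstrict [simp]: "modal_depth (cstrict d \<phi>) = 2 + modal_depth \<phi>"
  by (simp add: cstrict_def)


section \<open>Positions in another class\<close>

text \<open>Of two elements of \<open>T\<close> at most one lies in the class of \<open>i\<close>;
  conversely, an element outside that class is either the only one or has a companion. The
  right-hand side only counts up to two and looks into the class of \<open>i\<close>, which unary
  modalities can do.\<close>

lemma exists_other_class_iff:
  assumes "\<And>y z. \<lbrakk>y \<in> T; z \<in> T; same_class w y z\<rbrakk> \<Longrightarrow> y = z"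
  shows "(\<exists>y\<in>T. \<not> same_class w y i) \<longleftrightarrow>
    T \<noteq> {} \<and> ((\<exists>y\<in>T. \<exists>z\<in>T. y \<noteq> z) \<or> \<not> (\<exists>y\<in>T. same_class w y i))"
proof
  assume "\<exists>y\<in>T. \<not> same_class w y i"
  then obtain y where "y \<in> T" "\<not> same_class w y i" by blast
  then show "T \<noteq> {} \<and> ((\<exists>y\<in>T. \<exists>z\<in>T. y \<noteq> z) \<or> \<not> (\<exists>y\<in>T. same_class w y i))"
    by (metis empty_iff)
next
  assume *: "T \<noteq> {} \<and> ((\<exists>y\<in>T. \<exists>z\<in>T. y \<noteq> z) \<or> \<not> (\<exists>y\<in>T. same_class w y i))"
  have "y = z" if "y \<in> T" "z \<in> T" "same_class w y i" "same_class w z i" for y z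
    using assms that by (simp add: same_class_def)
  with * show "\<exists>y\<in>T. \<not> same_class w y i" by blast
qed

text \<open>For \<open>Future\<close> this marks the last \<phi>-position of a class, for
  \<open>Past\<close> the first.\<close>

definition class_extremal :: "dir \<Rightarrow> 'a dltl \<Rightarrow> 'a dltl" where
  "class_extremal d \<phi> = DAnd \<phi> (DNot (cstrict d \<phi>))"

lemma dltl_sat_class_extremal:
  "dltl_sat w i (class_extremal d \<phi>) \<longleftrightarrow> dltl_sat w i \<phi> \<and>
    (\<forall>j\<in>positions w. ahead d i j \<and> same_class w j i \<longrightarrow> \<not> dltl_sat w j \<phi>)"
  by (auto simp: class_extremal_def dltl_sat_cstrict)

text \<open>Of two distinct positions one is ahead of the other, which then is not extremal.\<close>

lemma class_extremal_unique:
  assumes "dltl_sat w i (class_extremal d \<phi>)" "dltl_sat w j (class_extremal d \<phi>)"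
    "i \<in> positions w" "j \<in> positions w" "same_class w i j"
  shows "i = j"
  using assms ahead_linear[of i j d] by (auto simp: dltl_sat_class_extremal same_class_sym)

definition far :: "dir \<Rightarrow> nat \<Rightarrow> nat \<Rightarrow> bool" where
  "far d i j \<longleftrightarrow> ahead d i j \<and> \<not> adjacent d i j"

text \<open>The criterion of \<open>exists_other_class_iff\<close> for the set of far extremal
  positions: nonempty, and with two elements or none in the class of \<open>i\<close>. The innermost
  conjunction with \<open>next_same\<close> says that the extremal position of the own class is the
  neighbour and hence not far.\<close>

definition far_other_extremal :: "dir \<Rightarrow> 'a dltl \<Rightarrow> 'a dltl" where
  "far_other_extremal d \<phi> = (let \<epsilon> = class_extremal d \<phi> in
     DAnd (gnext d (gstrict d \<epsilon>))
       (dor (gnext d (gstrict d (DAnd \<epsilon> (gstrict d \<epsilon>))))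
         (DNot (DAnd (cstrict d \<epsilon>) (DNot (DAnd (next_same d) (gnext d \<epsilon>)))))))"

text \<open>What lies strictly beyond the neighbour of \<open>i\<close> is exactly what is ahead of
  \<open>i\<close> without being adjacent.\<close>

lemma dltl_sat_gnext_gstrict:
  assumes "i \<in> positions w"
  shows "dltl_sat w i (gnext d (gstrict d \<phi>)) \<longleftrightarrow>
    (\<exists>j\<in>positions w. far d i j \<and> dltl_sat w j \<phi>)"
proof -
  have "(\<exists>j\<in>positions w. adjacent d i j \<and> ahead d j k) \<longleftrightarrow> far d i k" if k: "k \<in> positions w" for k
  proof
    assume "\<exists>j\<in>positions w. adjacent d i j \<and> ahead d j k"
    then obtain j where "adjacent d i j" "ahead d j k" by blast
    then show "far d i k"
      using adjacent_ahead[of d i j] ahead_trans[of d i j k] adjacent_unique[of d i j k]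
      by (auto simp: far_def)
  next
    assume far: "far d i k"
    then obtain j where "j \<in> positions w" "adjacent d i j"
      using adjacent_exists[OF assms k] by (auto simp: far_def)
    then show "\<exists>j\<in>positions w. adjacent d i j \<and> ahead d j k"
      using far adjacent_least[of d i j k] by (auto simp: far_def)
  qed
  then have "(\<exists>k\<in>positions w. far d i k \<and> dltl_sat w k \<phi>) \<longleftrightarrow>
    (\<exists>k\<in>positions w. (\<exists>j\<in>positions w. adjacent d i j \<and> ahead d j k) \<and> dltl_sat w k \<phi>)"
    by blast
  then show ?thesis by (auto simp: dltl_sat_gnext dltl_sat_gstrict)
qed

lemma dltl_sat_far_other_extremal:
  assumes i: "i \<in> positions w"
  shows "dltl_sat w i (far_other_extremal d \<phi>) \<longleftrightarrow>
    (\<exists>j\<in>positions w. far d i j \<and> \<not> same_class w j i \<and> dltl_sat w j (class_extremal d \<phi>))"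
proof -
  define E where "E j \<longleftrightarrow> dltl_sat w j (class_extremal d \<phi>)" for j
  define T where "T = {j \<in> positions w. far d i j \<and> E j}"
  have uniq: "j = k" if "E j" "E k" "j \<in> positions w" "k \<in> positions w" "same_class w j k" for j k
    using that class_extremal_unique unfolding E_def by metis
  \<comment> \<open>Of two far positions one is ahead of the other, and everything ahead of a far
    position is far; so the second one may be sought by \<open>gstrict\<close> alone.\<close>
  have two: "(\<exists>j\<in>positions w. far d i j \<and> E j \<and> (\<exists>k\<in>positions w. ahead d j k \<and> E k)) \<longleftrightarrow>
    (\<exists>y\<in>T. \<exists>z\<in>T. y \<noteq> z)"
  proof -
    have "far d i k" if "far d i j" "ahead d j k" for j k
      using that unfolding far_def
      by (metis adjacent_least ahead_irrefl ahead_trans)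
    then show ?thesis unfolding T_def using ahead_linear ahead_irrefl by (smt (verit) mem_Collect_eq)
  qed
  \<comment> \<open>The class of \<open>i\<close> has at most one extremal position. If that is the
    neighbour, no far one exists; otherwise an extremal position ahead is far.\<close>
  have own: "(\<exists>j\<in>positions w. ahead d i j \<and> same_class w j i \<and> E j) \<and>
      \<not> ((\<exists>j\<in>positions w. adjacent d i j \<and> same_class w j i) \<and>
        (\<exists>j\<in>positions w. adjacent d i j \<and> E j)) \<longleftrightarrow>
    (\<exists>y\<in>T. same_class w y i)" (is "?l \<longleftrightarrow> ?r")
  proof
    assume ?l
    then show ?r unfolding T_def far_def by blast
  next
    assume ?r
    then obtain y where y: "y \<in> positions w" "ahead d i y" "\<not> adjacent d i y" "E y" "same_class w y i"
      unfolding T_def far_def by blast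
    have "\<not> (adjacent d i j \<and> same_class w j i \<and> adjacent d i k \<and> E k)"
      if "j \<in> positions w" "k \<in> positions w" for j k
      using that y uniq adjacent_unique same_class_sym same_class_trans by metis
    with y show ?l by blast
  qed
  let ?\<epsilon> = "class_extremal d \<phi>"
  have "dltl_sat w i (gnext d (gstrict d ?\<epsilon>)) \<longleftrightarrow> T \<noteq> {}"
    by (auto simp: dltl_sat_gnext_gstrict[OF i] T_def E_def)
  moreover have "dltl_sat w i (gnext d (gstrict d (DAnd ?\<epsilon> (gstrict d ?\<epsilon>)))) \<longleftrightarrow>
    (\<exists>y\<in>T. \<exists>z\<in>T. y \<noteq> z)"
    unfolding two[symmetric]
    by (simp only: dltl_sat_gnext_gstrict[OF i] dltl_sat.simps dltl_sat_gstrict E_def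
        cong: bex_cong)
  moreover have "dltl_sat w i (cstrict d ?\<epsilon>) \<and>
      \<not> (dltl_sat w i (next_same d) \<and> dltl_sat w i (gnext d ?\<epsilon>)) \<longleftrightarrow>
    (\<exists>y\<in>T. same_class w y i)"
    unfolding own[symmetric]
    by (simp only: dltl_sat_cstrict dltl_sat_next_same[OF i] dltl_sat_gnext E_def)
  ultimately have "dltl_sat w i (far_other_extremal d \<phi>) \<longleftrightarrow>
    T \<noteq> {} \<and> ((\<exists>y\<in>T. \<exists>z\<in>T. y \<noteq> z) \<or> \<not> (\<exists>y\<in>T. same_class w y i))"
    unfolding far_other_extremal_def Let_def dltl_sat.simps(5,6) dltl_sat_dor by simp
  also have "\<dots> \<longleftrightarrow> (\<exists>y\<in>T. \<not> same_class w y i)"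
    by (rule exists_other_class_iff[symmetric]) (auto simp: T_def intro: uniq)
  finally show ?thesis by (auto simp: T_def E_def)
qed

section \<open>Classes with infinitely many witnesses\<close>

text \<open>Marks the first \<phi>-position of a class that has infinitely many: seen from there,
  \<open>Fc\<close> covers all \<phi>-positions of the class and finds no last one.\<close>

definition class_recurrent :: "'a dltl \<Rightarrow> 'a dltl" where
  "class_recurrent \<phi> =
     DAnd (class_extremal Past \<phi>) (DNot (DModal Fc (class_extremal Future \<phi>)))"

text \<open>Again the criterion of \<open>exists_other_class_iff\<close>, now for all
  representatives in the word. Their distance to \<open>i\<close> is irrelevant, since their classes
  have \<phi>-positions arbitrarily far ahead.\<close>

definition other_recurrent :: "'a dltl \<Rightarrow> 'a dltl" where
  "other_recurrent \<phi> = (let \<rho> = class_recurrent \<phi> in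
     DAnd (DModal Pg (DModal Fg \<rho>))
       (dor (DModal Pg (DModal Fg (DAnd \<rho> (gstrict Future \<rho>))))
         (DNot (dor (DModal Fc \<rho>) (DModal Pc \<rho>)))))"

text \<open>Go back to the smaller of \<open>i\<close> and \<open>j\<close>, then forward to
  \<open>j\<close>.\<close>

lemma dltl_sat_somewhere:
  assumes "i \<in> positions w"
  shows "dltl_sat w i (DModal Pg (DModal Fg \<phi>)) \<longleftrightarrow> (\<exists>j\<in>positions w. dltl_sat w j \<phi>)"
  using assms by simp (metis linear order_refl)

lemma dltl_sat_other_recurrent:
  assumes i: "i \<in> positions w"
  shows "dltl_sat w i (other_recurrent \<phi>) \<longleftrightarrow>
    (\<exists>j\<in>positions w. \<not> same_class w j i \<and> dltl_sat w j (class_recurrent \<phi>))"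
proof -
  define T where "T = {j \<in> positions w. dltl_sat w j (class_recurrent \<phi>)}"
  have two: "(\<exists>y\<in>T. \<exists>z\<in>positions w. y < z \<and> dltl_sat w z (class_recurrent \<phi>)) \<longleftrightarrow>
     (\<exists>y\<in>T. \<exists>z\<in>T. y \<noteq> z)"
    unfolding T_def using linorder_neq_iff by blast
  have own: "(\<exists>j\<in>positions w. i \<le> j \<and> same_class w j i \<and> dltl_sat w j (class_recurrent \<phi>)) \<or>
      (\<exists>j\<in>positions w. j \<le> i \<and> same_class w j i \<and> dltl_sat w j (class_recurrent \<phi>)) \<longleftrightarrow>
    (\<exists>y\<in>T. same_class w y i)"
    unfolding T_def using linear by blast
  have "dltl_sat w i (other_recurrent \<phi>) \<longleftrightarrow>
    T \<noteq> {} \<and> ((\<exists>y\<in>T. \<exists>z\<in>T. y \<noteq> z) \<or> \<not> (\<exists>y\<in>T. same_class w y i))"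
  proof -
    let ?\<rho> = "class_recurrent \<phi>"
    have "(\<exists>j\<in>positions w. dltl_sat w j ?\<rho>) \<longleftrightarrow> T \<noteq> {}"
      by (auto simp: T_def)
    moreover have "(\<exists>j\<in>positions w. dltl_sat w j ?\<rho> \<and> dltl_sat w j (gstrict Future ?\<rho>)) \<longleftrightarrow>
      (\<exists>y\<in>T. \<exists>z\<in>T. y \<noteq> z)"
      unfolding two[symmetric] unfolding T_def by (auto simp: dltl_sat_gstrict)
    moreover have "dltl_sat w i (DModal Fc ?\<rho>) \<or> dltl_sat w i (DModal Pc ?\<rho>) \<longleftrightarrow>
      (\<exists>y\<in>T. same_class w y i)"
      unfolding own[symmetric] by simp
    ultimately show ?thesis
      unfolding other_recurrent_def Let_def dltl_sat.simps(5,6) dltl_sat_dor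
        dltl_sat_somewhere[OF i]
      by simp
  qed
  also have "\<dots> \<longleftrightarrow> (\<exists>y\<in>T. \<not> same_class w y i)"
    by (rule exists_other_class_iff[symmetric])
      (auto simp: T_def class_recurrent_def intro: class_extremal_unique)
  finally show ?thesis by (auto simp: T_def)
qed

text \<open>Backwards, a class with a \<phi>-position has a first one. Forwards, a last one may be
  missing; the second disjunct covers this case.\<close>

definition far_other :: "dir \<Rightarrow> 'a dltl \<Rightarrow> 'a dltl" where
  "far_other d \<phi> = (case d of
     Future \<Rightarrow> dor (far_other_extremal Future \<phi>) (other_recurrent \<phi>)
   | Past \<Rightarrow> far_other_extremal Past \<phi>)"

lemma class_first_exists:
  assumes "y \<in> positions w" "dltl_sat w y \<phi>"
  obtains f where "f \<in> positions w" "f \<le> y" "same_class w f y" "dltl_sat w f (class_extremal Past \<phi>)"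
proof -
  let ?P = "\<lambda>j. j \<in> positions w \<and> same_class w j y \<and> dltl_sat w j \<phi>"
  have y: "?P y" using assms by simp
  obtain f where f: "?P f" and le: "\<And>j. ?P j \<Longrightarrow> f \<le> j"
    using ex_has_least_nat[of ?P y id] y by auto
  have "\<not> dltl_sat w j \<phi>" if "j \<in> positions w" "j < f" "same_class w j f" for j
    using le[of j] same_class_trans[of w j f y] f that by auto
  then have "dltl_sat w f (class_extremal Past \<phi>)"
    unfolding dltl_sat_class_extremal using f by auto
  with f le[OF y] that show thesis by blast
qed

text \<open>If the \<phi>-positions of the class were bounded, the greatest would be extremal for
  \<open>Future\<close>, and \<open>Fc\<close> would reach it from \<open>f\<close>.\<close>

lemma class_recurrent_unbounded:
  assumes "f \<in> positions w" "dltl_sat w f (class_recurrent \<phi>)"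
  shows "\<exists>y\<in>positions w. n < y \<and> same_class w y f \<and> dltl_sat w y \<phi>"
proof (rule ccontr)
  assume contra: "\<not> ?thesis"
  let ?P = "\<lambda>j. j \<in> positions w \<and> same_class w j f \<and> dltl_sat w j \<phi>"
  have f: "?P f" using assms by (auto simp: class_recurrent_def dltl_sat_class_extremal)
  have bound: "j \<le> n" if "?P j" for j using contra that by (meson not_le)
  obtain m where m: "?P m" and le: "\<And>j. ?P j \<Longrightarrow> j \<le> m"
    using ex_has_greatest_nat[of ?P f id "Suc n"] f bound by (auto simp: less_Suc_eq_le)
  have "\<not> dltl_sat w j \<phi>" if "j \<in> positions w" "m < j" "same_class w j m" for j
    using le[of j] same_class_trans[of w j m f] m that by auto
  then have "dltl_sat w m (class_extremal Future \<phi>)"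
    unfolding dltl_sat_class_extremal using m by auto
  with assms m le[OF f] show False by (auto simp: class_recurrent_def)
qed

text \<open>A witness can be exchanged for the extremal \<phi>-position of its class: this is no
  nearer to \<open>i\<close>, hence still far, and stays outside the class of \<open>i\<close>. If
  the class has no last \<phi>-position, its recurrent representative takes over.\<close>

lemma dltl_sat_far_other:
  assumes i: "i \<in> positions w"
  shows "dltl_sat w i (far_other d \<phi>) \<longleftrightarrow>
    (\<exists>j\<in>positions w. far d i j \<and> \<not> same_class w j i \<and> dltl_sat w j \<phi>)" (is "?l \<longleftrightarrow> ?r")
proof (cases d)
  case Past
  have "\<exists>f\<in>positions w. far d i f \<and> \<not> same_class w f i \<and> dltl_sat w f (class_extremal d \<phi>)"
    if y: "y \<in> positions w" "far d i y" "\<not> same_class w y i" "dltl_sat w y \<phi>" for y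
  proof -
    obtain f where f: "f \<in> positions w" "f \<le> y" "same_class w f y"
      "dltl_sat w f (class_extremal Past \<phi>)"
      using class_first_exists y by metis
    have "\<not> same_class w f i"
      using f(3) y(3) same_class_sym same_class_trans by metis
    with f y Past show ?thesis by (intro bexI[of _ f]) (auto simp: far_def)
  qed
  then show ?thesis using i Past
    by (auto simp: far_other_def dltl_sat_far_other_extremal dltl_sat_class_extremal)
next
  case Future
  show ?thesis
  proof
    assume ?l
    then consider "dltl_sat w i (far_other_extremal Future \<phi>)" | "dltl_sat w i (other_recurrent \<phi>)"
      using Future by (auto simp: far_other_def)
    then show ?r
    proof cases
      case 1
      then show ?thesis using i Future
        by (auto simp: dltl_sat_far_other_extremal dltl_sat_class_extremal)
    next
      case 2
      then obtain f where f: "f \<in> positions w" "\<not> same_class w f i"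
        "dltl_sat w f (class_recurrent \<phi>)"
        using i by (auto simp: dltl_sat_other_recurrent)
      \<comment> \<open>The bound \<open>i + 1\<close> yields a position ahead of \<open>i\<close>
        and not adjacent to it.\<close>
      obtain y where y: "y \<in> positions w" "i + 1 < y" "same_class w y f" "dltl_sat w y \<phi>"
        using class_recurrent_unbounded[OF f(1,3)] by blast
      have "\<not> same_class w y i"
        using y(3) f(2) same_class_sym same_class_trans by metis
      with y Future show ?thesis by (intro bexI[of _ y]) (auto simp: far_def)
    qed
  next
    assume ?r
    then obtain y where y: "y \<in> positions w" "far Future i y" "\<not> same_class w y i" "dltl_sat w y \<phi>"
      using Future by auto
    show ?l
    proof (cases "\<exists>l\<in>positions w. y \<le> l \<and> same_class w l y \<and>
        dltl_sat w l (class_extremal Future \<phi>)")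
      case True
      then obtain l where l: "l \<in> positions w" "y \<le> l" "same_class w l y"
        "dltl_sat w l (class_extremal Future \<phi>)" by blast
      have "\<not> same_class w l i"
        using l(3) y(3) same_class_sym same_class_trans by metis
      moreover have "far Future i l" using y(2) l(2) by (auto simp: far_def)
      ultimately have "dltl_sat w i (far_other_extremal Future \<phi>)"
        using i l by (auto simp: dltl_sat_far_other_extremal)
      then show ?thesis using Future by (simp add: far_other_def)
    next
      case False
      obtain f where f: "f \<in> positions w" "f \<le> y" "same_class w f y"
        "dltl_sat w f (class_extremal Past \<phi>)"
        using class_first_exists y by metis
      \<comment> \<open>From \<open>y\<close> on, an extremal position is excluded by the case
        assumption; before \<open>y\<close>, by \<open>y\<close> itself.\<close>
      have "\<not> dltl_sat w l (class_extremal Future \<phi>)"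
        if l: "l \<in> positions w" "f \<le> l" "same_class w l f" for l
      proof
        assume ext: "dltl_sat w l (class_extremal Future \<phi>)"
        have ly: "same_class w l y" using l(3) f(3) same_class_trans by metis
        with False l ext have "l < y" by (meson not_le)
        with ext ly y show False by (auto simp: dltl_sat_class_extremal same_class_sym)
      qed
      then have "dltl_sat w f (class_recurrent \<phi>)" using f by (auto simp: class_recurrent_def)
      moreover have "\<not> same_class w f i"
        using f(3) y(3) same_class_sym same_class_trans by metis
      ultimately show ?thesis using i f Future
        by (auto simp: far_other_def dltl_sat_other_recurrent)
    qed
  qed
qed


section \<open>Types of pairs of positions\<close>

datatype kind = Adj_Same | Adj_Other | Next_Same | Far_Same | Far_Other

datatype rtype = Equal | Dir dir kind

text \<open>The order of the tests makes the kinds exclusive: \<open>Next_Same\<close> is a class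
  neighbour that is not adjacent, and the two far kinds are neither adjacent nor class
  neighbours.\<close>

definition kind_of :: "('a, 'd) data_word \<Rightarrow> dir \<Rightarrow> nat \<Rightarrow> nat \<Rightarrow> kind" where
  "kind_of w d i j =
     (if adjacent d i j then if same_class w j i then Adj_Same else Adj_Other
      else if class_next w d i j then Next_Same
      else if same_class w j i then Far_Same else Far_Other)"

definition rel_of :: "('a, 'd) data_word \<Rightarrow> nat \<Rightarrow> nat \<Rightarrow> rtype" where
  "rel_of w i j =
     (if i = j then Equal
      else let d = (if i < j then Future else Past) in Dir d (kind_of w d i j))"

fun rconv :: "rtype \<Rightarrow> rtype" where
  "rconv Equal = Equal"
| "rconv (Dir d k) = Dir (opposite d) k"

lemma rconv_rconv [simp]: "rconv (rconv \<tau>) = \<tau>"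
  by (cases \<tau>) auto

text \<open>Adjacency, class neighbourhood and \<open>same_class\<close> look alike from both ends,
  so reversing a pair only flips the direction of its type.\<close>

lemma kind_of_opposite:
  assumes "i \<in> positions w" "j \<in> positions w"
  shows "kind_of w (opposite d) j i = kind_of w d i j"
  using assms by (cases d) (auto simp: kind_of_def class_succ_iff_class_pred same_class_sym)

lemma rel_of_conv:
  assumes "i \<in> positions w" "j \<in> positions w"
  shows "rel_of w j i = rconv (rel_of w i j)"
  using kind_of_opposite[OF assms, of Future] kind_of_opposite[OF assms, of Past]
  by (auto simp: rel_of_def)

lemma rel_of_eq_Dir_iff: "rel_of w i j = Dir d k \<longleftrightarrow> ahead d i j \<and> kind_of w d i j = k"
  by (cases d) (auto simp: rel_of_def Let_def)

definition all_kinds :: "kind list" where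
  "all_kinds = [Adj_Same, Adj_Other, Next_Same, Far_Same, Far_Other]"

definition all_rtypes :: "rtype list" where
  "all_rtypes = Equal # map (Dir Future) all_kinds @ map (Dir Past) all_kinds"

lemma set_all_rtypes: "\<tau> \<in> set all_rtypes"
proof (cases \<tau>)
  case (Dir d k)
  then show ?thesis by (cases d; cases k) (auto simp: all_rtypes_def all_kinds_def)
qed (simp add: all_rtypes_def)

lemma length_all_rtypes: "length all_rtypes = 11"
  by (simp add: all_rtypes_def all_kinds_def)

text \<open>Conditions on the target may be split into separate conjuncts because the neighbour and
  the class neighbour are unique.\<close>

fun diamond :: "rtype \<Rightarrow> 'a dltl \<Rightarrow> 'a dltl" where
  "diamond Equal \<phi> = \<phi>"
| "diamond (Dir d Adj_Same) \<phi> = DAnd (next_same d) (gnext d \<phi>)"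
| "diamond (Dir d Adj_Other) \<phi> = DAnd (DNot (next_same d)) (gnext d \<phi>)"
| "diamond (Dir d Next_Same) \<phi> = DAnd (DNot (next_same d)) (cnext d \<phi>)"
| "diamond (Dir d Far_Same) \<phi> = cnext d (cstrict d \<phi>)"
| "diamond (Dir d Far_Other) \<phi> = far_other d \<phi>"

lemma adjacent_same_class_next:
  "\<lbrakk>adjacent d i j; same_class w j i; j \<in> positions w\<rbrakk> \<Longrightarrow> class_next w d i j"
  using adjacent_ahead adjacent_least unfolding class_next_iff by metis

lemma class_next_unique: "class_next w d i j \<Longrightarrow> class_next w d i k \<Longrightarrow> j = k"
  unfolding class_next_iff by (metis ahead_irrefl ahead_trans)

lemma dltl_sat_diamond:
  assumes i: "i \<in> positions w"
  shows "dltl_sat w i (diamond \<tau> \<phi>) \<longleftrightarrow> (\<exists>j\<in>positions w. rel_of w i j = \<tau> \<and> dltl_sat w j \<phi>)"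
proof (cases \<tau>)
  case Equal
  then show ?thesis using i by (auto simp: rel_of_def Let_def)
next
  case [simp]: (Dir d k)
  show ?thesis
  proof (cases k)
    case Adj_Same
    have "ahead d i j \<and> kind_of w d i j = Adj_Same \<longleftrightarrow> adjacent d i j \<and> same_class w j i" for j
      using adjacent_ahead by (auto simp: kind_of_def)
    with Adj_Same show ?thesis using i adjacent_unique
      by (simp add: rel_of_eq_Dir_iff dltl_sat_next_same dltl_sat_gnext) blast
  next
    case Adj_Other
    have "ahead d i j \<and> kind_of w d i j = Adj_Other \<longleftrightarrow> adjacent d i j \<and> \<not> same_class w j i" for j
      using adjacent_ahead by (auto simp: kind_of_def)
    with Adj_Other show ?thesis using i adjacent_unique
      by (simp add: rel_of_eq_Dir_iff dltl_sat_next_same dltl_sat_gnext) blast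
  next
    case Next_Same
    \<comment> \<open>The class neighbour is adjacent exactly when some adjacent position belongs to
      the class.\<close>
    have "ahead d i j \<and> kind_of w d i j = Next_Same \<longleftrightarrow>
      class_next w d i j \<and> \<not> (\<exists>k\<in>positions w. adjacent d i k \<and> same_class w k i)" for j
      unfolding kind_of_def
      using class_next_iff[of w d i j]
      by auto (metis adjacent_same_class_next class_next_unique)
    with Next_Same show ?thesis using i
      by (auto simp: rel_of_eq_Dir_iff dltl_sat_next_same dltl_sat_cnext)
  next
    case Far_Same
    have "ahead d i j \<and> kind_of w d i j = Far_Same \<longleftrightarrow>
      (\<exists>k\<in>positions w. class_next w d i k \<and> ahead d k j \<and> same_class w j k)"
      if j: "j \<in> positions w" for j
    proof -
      \<comment> \<open>An adjacent position of the same class is a class neighbour, so excluding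
        \<open>class_next\<close> excludes both.\<close>
      have "ahead d i j \<and> kind_of w d i j = Far_Same \<longleftrightarrow>
        ahead d i j \<and> same_class w j i \<and> \<not> class_next w d i j"
        unfolding kind_of_def using adjacent_same_class_next j by auto
      also have "\<dots> \<longleftrightarrow> (\<exists>k\<in>positions w. class_next w d i k \<and> ahead d k j \<and> same_class w j k)"
      proof
        assume *: "ahead d i j \<and> same_class w j i \<and> \<not> class_next w d i j"
        then obtain k where k: "class_next w d i k" using class_next_exists j by blast
        then have "k \<in> positions w" "same_class w k i" "k = j \<or> ahead d k j"
          using * j unfolding class_next_iff by auto
        with k * show "\<exists>k\<in>positions w. class_next w d i k \<and> ahead d k j \<and> same_class w j k"
          by (metis same_class_sym same_class_trans)
      next
        assume "\<exists>k\<in>positions w. class_next w d i k \<and> ahead d k j \<and> same_class w j k"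
        then obtain k where k: "class_next w d i k" "ahead d k j" "same_class w j k" by blast
        then have "k \<noteq> j" by auto
        with k show "ahead d i j \<and> same_class w j i \<and> \<not> class_next w d i j"
          by (metis ahead_trans class_next_iff class_next_unique same_class_trans)
      qed
      finally show ?thesis .
    qed
    with Far_Same show ?thesis
      by (auto simp: rel_of_eq_Dir_iff dltl_sat_cnext dltl_sat_cstrict)
  next
    case Far_Other
    have "ahead d i j \<and> kind_of w d i j = Far_Other \<longleftrightarrow> far d i j \<and> \<not> same_class w j i" for j
      unfolding kind_of_def far_def class_next_iff by auto
    with Far_Other show ?thesis using i
      by (auto simp: rel_of_eq_Dir_iff dltl_sat_far_other)
  qed
qed

lemma dltl_size_pos: "1 \<le> dltl_size \<phi>"
  by (cases \<phi>) auto

lemmas operator_defs = far_other_def far_other_extremal_def other_recurrent_def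
  class_recurrent_def class_extremal_def Let_def

text \<open>The largest case, \<open>far_other Future\<close>, has size
  \<open>30 * dltl_size \<phi> + 120\<close>, and sizes are at least 1.\<close>

lemma dltl_size_diamond: "dltl_size (diamond \<tau> \<phi>) \<le> 150 * dltl_size \<phi>"
proof (cases "(\<tau>, \<phi>)" rule: diamond.cases)
  case (6 d \<phi>)
  then show ?thesis using dltl_size_pos[of \<phi>] by (cases d) (simp_all add: operator_defs)
qed (use dltl_size_pos[of \<phi>] in simp_all)

text \<open>The bound 7 is attained where \<open>far_other_extremal\<close> looks for a second
  element: \<open>gnext\<close> and two \<open>gstrict\<close> give 5, and
  \<open>class_extremal\<close> adds 2.\<close>

lemma modal_depth_diamond: "modal_depth (diamond \<tau> \<phi>) \<le> 7 + modal_depth \<phi>"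
proof (cases "(\<tau>, \<phi>)" rule: diamond.cases)
  case (6 d \<phi>)
  then show ?thesis by (cases d) (simp_all add: operator_defs)
qed simp_all


section \<open>From two-variable logic to unary-DLTL\<close>

text \<open>
  A triple \<open>(A, R, B)\<close> stands for \<open>A(x) \<and> rel_of x y \<in> R \<and> B(y)\<close>, and a list of triples for
  their disjunction.
\<close>

type_synonym 'a triple = "'a dltl \<times> rtype set \<times> 'a dltl"

fun triple_sat :: "('a, 'd) data_word \<Rightarrow> nat \<Rightarrow> nat \<Rightarrow> 'a triple \<Rightarrow> bool" where
  "triple_sat w i j (A, R, B) \<longleftrightarrow> dltl_sat w i A \<and> rel_of w i j \<in> R \<and> dltl_sat w j B"

fun triple_and :: "'a triple \<Rightarrow> 'a triple \<Rightarrow> 'a triple" where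
  "triple_and (A, R, B) (A', R', B') = (DAnd A A', R \<inter> R', DAnd B B')"

fun triple_swap :: "'a triple \<Rightarrow> 'a triple" where
  "triple_swap (A, R, B) = (B, rconv ` R, A)"

fun rel_between :: "rtype \<Rightarrow> var \<Rightarrow> var \<Rightarrow> rtype" where
  "rel_between \<tau> VX VY = \<tau>"
| "rel_between \<tau> VY VX = rconv \<tau>"
| "rel_between \<tau> _ _ = Equal"

definition lit :: "bool \<Rightarrow> 'a dltl \<Rightarrow> 'a dltl" where
  "lit b A = (if b then A else DNot A)"

definition unary :: "var \<Rightarrow> 'a dltl \<Rightarrow> 'a triple list" where
  "unary u A = [if u = VX then (A, UNIV, dtrue) else (dtrue, UNIV, A)]"

text \<open>As the types partition all pairs, negating an atom just complements its set of
  types.\<close>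

definition binary :: "bool \<Rightarrow> var \<Rightarrow> var \<Rightarrow> rtype set \<Rightarrow> 'a triple list" where
  "binary b u v R = [(dtrue, {\<tau>. (rel_between \<tau> u v \<in> R) = b}, dtrue)]"

fun triple_diamonds :: "'a triple \<Rightarrow> 'a dltl list" where
  "triple_diamonds (A, R, B) = map (\<lambda>\<tau>. DAnd A (diamond \<tau> B)) (filter (\<lambda>\<tau>. \<tau> \<in> R) all_rtypes)"

definition elim_ex :: "'a triple list \<Rightarrow> 'a dltl" where
  "elim_ex ts = disj (concat (map triple_diamonds ts))"

text \<open>\<open>elim_ex\<close> removes the second component, so triples are swapped when
  \<open>x\<close> is quantified.\<close>

definition elim_var :: "var \<Rightarrow> 'a triple list \<Rightarrow> 'a dltl" where
  "elim_var u ts = elim_ex (if u = VY then ts else map triple_swap ts)"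

text \<open>With \<open>b\<close> false the negation is normalised, so a disjunction of triples is
  never complemented. A quantified formula becomes a single literal; \<open>FAll\<close> is read as
  the negation of an existential over the negated body.\<close>

fun dnf :: "'a fo2 \<Rightarrow> bool \<Rightarrow> 'a triple list" where
  "dnf (FLabel a u) b = unary u (lit b (DLabel a))"
| "dnf (FEq u v) b = binary b u v {Equal}"
| "dnf (FLess u v) b = binary b u v (range (Dir Future))"
| "dnf (FSucc u v) b = binary b u v {Dir Future Adj_Same, Dir Future Adj_Other}"
| "dnf (FSim u v) b =
     binary b u v (insert Equal {Dir d k | d k. k \<in> {Adj_Same, Next_Same, Far_Same}})"
| "dnf (FClassSucc u v) b = binary b u v {Dir Future Adj_Same, Dir Future Next_Same}"
| "dnf (FNot \<phi>) b = dnf \<phi> (\<not> b)"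
| "dnf (FAnd \<phi> \<psi>) b =
     (if b then map (\<lambda>(s, t). triple_and s t) (List.product (dnf \<phi> b) (dnf \<psi> b))
      else dnf \<phi> b @ dnf \<psi> b)"
| "dnf (FOr \<phi> \<psi>) b =
     (if b then dnf \<phi> b @ dnf \<psi> b
      else map (\<lambda>(s, t). triple_and s t) (List.product (dnf \<phi> b) (dnf \<psi> b)))"
| "dnf (FEx u \<phi>) b = unary (other u) (lit b (elim_var u (dnf \<phi> True)))"
| "dnf (FAll u \<phi>) b = unary (other u) (lit (\<not> b) (elim_var u (dnf \<phi> False)))"

section \<open>Correctness of the normal form\<close>

lemma triple_sat_and [simp]:
  "triple_sat w i j (triple_and s t) \<longleftrightarrow> triple_sat w i j s \<and> triple_sat w i j t"
  by (cases s; cases t) auto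

lemma triple_sat_swap:
  assumes "i \<in> positions w" "j \<in> positions w"
  shows "triple_sat w i j (triple_swap t) \<longleftrightarrow> triple_sat w j i t"
proof (cases t)
  case (fields A R B)
  have "rel_of w i j \<in> rconv ` R \<longleftrightarrow> rel_of w j i \<in> R"
    using rel_of_conv[OF assms] by (metis image_iff rconv_rconv)
  with fields show ?thesis by auto
qed

lemma dltl_sat_lit [simp]: "dltl_sat w i (lit b A) \<longleftrightarrow> (dltl_sat w i A = b)"
  by (simp add: lit_def)

lemma unary_sat [simp]:
  "(\<exists>t\<in>set (unary u A). triple_sat w (\<sigma> VX) (\<sigma> VY) t) \<longleftrightarrow> dltl_sat w (\<sigma> u) A"
  by (cases u) (auto simp: unary_def)

lemma rel_between_rel_of:
  assumes "\<And>u. \<sigma> u \<in> positions w"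
  shows "rel_between (rel_of w (\<sigma> VX) (\<sigma> VY)) u v = rel_of w (\<sigma> u) (\<sigma> v)"
  using rel_of_conv[of "\<sigma> VX" w "\<sigma> VY"] assms
  by (cases u; cases v) (auto simp: rel_of_def)

lemma binary_sat:
  assumes "\<And>u. \<sigma> u \<in> positions w"
  shows "(\<exists>t\<in>set (binary b u v R). triple_sat w (\<sigma> VX) (\<sigma> VY) t) \<longleftrightarrow>
    (rel_of w (\<sigma> u) (\<sigma> v) \<in> R) = b"
  using rel_between_rel_of[of \<sigma> w u v] assms by (simp add: binary_def)

lemma triple_diamonds_sat:
  assumes "i \<in> positions w"
  shows "(\<exists>\<phi>\<in>set (triple_diamonds t). dltl_sat w i \<phi>) \<longleftrightarrow> (\<exists>j\<in>positions w. triple_sat w i j t)"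
  by (cases t) (auto simp: dltl_sat_diamond[OF assms] set_all_rtypes)

lemma elim_ex_sat:
  assumes "i \<in> positions w"
  shows "dltl_sat w i (elim_ex ts) \<longleftrightarrow> (\<exists>j\<in>positions w. \<exists>t\<in>set ts. triple_sat w i j t)"
  using triple_diamonds_sat[OF assms] by (auto simp: elim_ex_def)

lemma elim_var_sat:
  assumes "\<sigma> (other u) \<in> positions w"
  shows "dltl_sat w (\<sigma> (other u)) (elim_var u ts) \<longleftrightarrow>
    (\<exists>p\<in>positions w. \<exists>t\<in>set ts. triple_sat w ((\<sigma>(u := p)) VX) ((\<sigma>(u := p)) VY) t)"
  using assms by (cases u) (auto simp: elim_var_def elim_ex_sat triple_sat_swap)

lemma kind_of_same:
  "kind_of w d i j \<in> {Adj_Same, Next_Same, Far_Same} \<longleftrightarrow> same_class w j i"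
  by (auto simp: kind_of_def class_next_iff)

text \<open>Every atomic relation is a union of types; these are the sets used in
  \<open>dnf\<close>.\<close>

lemma rel_of_atoms:
  assumes "i \<in> positions w" "j \<in> positions w"
  shows "rel_of w i j = Equal \<longleftrightarrow> i = j"
    and "rel_of w i j \<in> range (Dir Future) \<longleftrightarrow> i < j"
    and "rel_of w i j \<in> {Dir Future Adj_Same, Dir Future Adj_Other} \<longleftrightarrow> i + 1 = j"
    and "rel_of w i j \<in> insert Equal {Dir d k | d k. k \<in> {Adj_Same, Next_Same, Far_Same}}
      \<longleftrightarrow> same_class w i j"
    and "rel_of w i j \<in> {Dir Future Adj_Same, Dir Future Next_Same} \<longleftrightarrow> is_class_succ w i j"
proof -
  show "rel_of w i j = Equal \<longleftrightarrow> i = j"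
    and "rel_of w i j \<in> range (Dir Future) \<longleftrightarrow> i < j"
    and "rel_of w i j \<in> {Dir Future Adj_Same, Dir Future Adj_Other} \<longleftrightarrow> i + 1 = j"
    by (auto simp: rel_of_def Let_def kind_of_def)
  show "rel_of w i j \<in> insert Equal {Dir d k | d k. k \<in> {Adj_Same, Next_Same, Far_Same}}
      \<longleftrightarrow> same_class w i j"
  proof (cases "i = j")
    case False
    then obtain d where "rel_of w i j = Dir d (kind_of w d i j)"
      by (auto simp: rel_of_def Let_def)
    then show ?thesis
      using kind_of_same[of w d i j] same_class_sym[of w i j] by auto
  qed (simp add: rel_of_def)
  show "rel_of w i j \<in> {Dir Future Adj_Same, Dir Future Next_Same} \<longleftrightarrow> is_class_succ w i j"
    using adjacent_same_class_next[of Future i j w] assms(2) class_next_iff[of w Future i j]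
    by (auto simp: rel_of_eq_Dir_iff kind_of_def)
qed

text \<open>Both variables have to denote positions, free or not, because reversing types and
  eliminating quantifiers are sound only there.\<close>

lemma dnf_sat:
  "(\<And>u. \<sigma> u \<in> positions w) \<Longrightarrow>
    (\<exists>t\<in>set (dnf \<phi> b). triple_sat w (\<sigma> VX) (\<sigma> VY) t) \<longleftrightarrow> fo2_sat w \<sigma> \<phi> = b"
proof (induction \<phi> arbitrary: b \<sigma>)
  case (FLabel a u)
  then show ?case by simp
next
  case (FEq u v)
  then show ?case by (simp only: dnf.simps fo2_sat.simps binary_sat singleton_iff rel_of_atoms)
next
  case (FLess u v)
  then show ?case by (simp only: dnf.simps fo2_sat.simps binary_sat rel_of_atoms)
next
  case (FSucc u v)
  then show ?case by (simp only: dnf.simps fo2_sat.simps binary_sat rel_of_atoms)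
next
  case (FSim u v)
  then show ?case by (simp only: dnf.simps fo2_sat.simps binary_sat rel_of_atoms)
next
  case (FClassSucc u v)
  then show ?case by (simp only: dnf.simps fo2_sat.simps binary_sat rel_of_atoms)
next
  case (FNot \<phi>)
  then show ?case by auto
next
  case (FAnd \<phi> \<psi>)
  show ?case using FAnd.IH(1)[OF FAnd.prems, of b] FAnd.IH(2)[OF FAnd.prems, of b] by force
next
  case (FOr \<phi> \<psi>)
  show ?case using FOr.IH(1)[OF FOr.prems, of b] FOr.IH(2)[OF FOr.prems, of b] by force
next
  case (FEx u \<phi>)
  have "(\<exists>t\<in>set (dnf \<phi> True). triple_sat w ((\<sigma>(u := p)) VX) ((\<sigma>(u := p)) VY) t) \<longleftrightarrow>
    fo2_sat w (\<sigma>(u := p)) \<phi>" if "p \<in> positions w" for p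
  proof -
    have "(\<sigma>(u := p)) v \<in> positions w" for v using FEx.prems that by simp
    from FEx.IH[OF this, of True] show ?thesis by (simp only: simp_thms)
  qed
  then show ?case
    by (simp only: dnf.simps unary_sat dltl_sat_lit elim_var_sat[of \<sigma> u w, OF FEx.prems] fo2_sat.simps
        cong: bex_cong)
next
  case (FAll u \<phi>)
  have "(\<exists>t\<in>set (dnf \<phi> False). triple_sat w ((\<sigma>(u := p)) VX) ((\<sigma>(u := p)) VY) t) \<longleftrightarrow>
    \<not> fo2_sat w (\<sigma>(u := p)) \<phi>" if "p \<in> positions w" for p
  proof -
    have "(\<sigma>(u := p)) v \<in> positions w" for v using FAll.prems that by simp
    from FAll.IH[OF this, of False] show ?thesis by (simp only: simp_thms)
  qed
  then show ?case
    by (simp only: dnf.simps unary_sat dltl_sat_lit elim_var_sat[of \<sigma> u w, OF FAll.prems] fo2_sat.simps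
        cong: bex_cong) blast
qed

section \<open>Size of the normal form\<close>

text \<open>The summand 2 pays for the two conjunctions created by \<open>triple_and\<close>, which
  makes the weight additive.\<close>

fun weight :: "'a triple \<Rightarrow> nat" where
  "weight (A, R, B) = dltl_size A + dltl_size B + 2"

definition total_weight :: "'a triple list \<Rightarrow> nat" where
  "total_weight ts = sum_list (map weight ts)"

lemma weight_ge: "4 \<le> weight t"
proof (cases t)
  case (fields A R B)
  then show ?thesis using dltl_size_pos[of A] dltl_size_pos[of B] by simp
qed

lemma weight_and: "weight (triple_and s t) = weight s + weight t"
  by (cases s; cases t) auto

lemma weight_swap [simp]: "weight (triple_swap t) = weight t"
  by (cases t) auto

lemma add_le_mult_nat: "\<lbrakk>2 \<le> m; 2 \<le> n\<rbrakk> \<Longrightarrow> m + n \<le> m * (n::nat)"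
  by (metis add_le_mono le_trans mult_2 mult_2_right mult_le_mono nat_le_linear order_refl)

text \<open>The left side sums \<open>weight s + weight t\<close> over all pairs; each summand is at
  most \<open>weight s * weight t\<close>, and the product distributes.\<close>

lemma total_weight_product:
  "total_weight (map (\<lambda>(s, t). triple_and s t) (List.product ss ts)) \<le>
     total_weight ss * total_weight ts"
proof (induction ss)
  case (Cons s ss)
  have "total_weight (map (triple_and s) ts) \<le> weight s * total_weight ts"
  proof (induction ts)
    case (Cons t ts)
    have "weight s + weight t \<le> weight s * weight t"
      using weight_ge[of s] weight_ge[of t] by (intro add_le_mult_nat) auto
    with Cons show ?case by (simp add: total_weight_def weight_and algebra_simps)
  qed (simp add: total_weight_def)
  with Cons show ?case by (simp add: total_weight_def algebra_simps comp_def)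
qed (simp add: total_weight_def)

lemma total_weight_ge: "ts \<noteq> [] \<Longrightarrow> 4 \<le> total_weight ts"
  using weight_ge by (cases ts) (auto simp: total_weight_def intro: trans_le_add1)

text \<open>An empty list has total weight 0, which would spoil bounding a sum by a product.\<close>

lemma dnf_nonempty: "dnf \<phi> b \<noteq> []"
proof (induction \<phi> arbitrary: b)
  case (FAnd \<phi> \<psi>)
  then show ?case by (cases "dnf \<phi> b"; cases "dnf \<psi> b") auto
next
  case (FOr \<phi> \<psi>)
  then show ?case by (cases "dnf \<phi> b"; cases "dnf \<psi> b") auto
qed (auto simp: unary_def binary_def)

lemma total_weight_append_le:
  "\<lbrakk>ss \<noteq> []; ts \<noteq> []\<rbrakk> \<Longrightarrow> total_weight (ss @ ts) \<le> total_weight ss * total_weight ts"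
  using add_le_mult_nat[of "total_weight ss" "total_weight ts"] total_weight_ge[of ss]
    total_weight_ge[of ts]
  by (simp add: total_weight_def)

text \<open>\<open>1650 = 11 * 150\<close>: eleven types, each with the factor of
  \<open>dltl_size_diamond\<close>.\<close>

lemma triple_diamonds_size:
  "(\<Sum>\<phi>\<leftarrow>triple_diamonds t. dltl_size \<phi> + 4) \<le> 1650 * weight t"
proof (cases t)
  case (fields A R B)
  let ?f = "\<lambda>\<tau>. dltl_size (DAnd A (diamond \<tau> B)) + 4"
  have "?f \<tau> \<le> 150 * weight t" for \<tau>
    using fields dltl_size_diamond[of \<tau> B] by simp
  then have "(\<Sum>\<tau>\<leftarrow>filter (\<lambda>\<tau>. \<tau> \<in> R) all_rtypes. ?f \<tau>) \<le>
    (\<Sum>\<tau>\<leftarrow>filter (\<lambda>\<tau>. \<tau> \<in> R) all_rtypes. 150 * weight t)"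
    by (intro sum_list_mono)
  also have "\<dots> \<le> 11 * (150 * weight t)"
    using length_filter_le[of "\<lambda>\<tau>. \<tau> \<in> R" all_rtypes]
    by (simp only: sum_list_triv of_nat_id length_all_rtypes mult_le_mono1)
  finally show ?thesis using fields by (simp add: comp_def)
qed

lemma elim_ex_size: "dltl_size (elim_ex ts) \<le> 4 + 1650 * total_weight ts"
proof -
  have "(\<Sum>\<phi>\<leftarrow>concat (map triple_diamonds ts). dltl_size \<phi> + 4) \<le> 1650 * total_weight ts"
  proof (induction ts)
    case (Cons t ts)
    then show ?case using triple_diamonds_size[of t]
      by (simp add: total_weight_def)
  qed simp
  then show ?thesis by (simp add: elim_ex_def dltl_size_disj)
qed

lemma elim_var_size: "dltl_size (elim_var u ts) \<le> 4 + 1650 * total_weight ts"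
proof -
  have "total_weight (map triple_swap ts) = total_weight ts"
    by (simp add: total_weight_def comp_def)
  then show ?thesis
    using elim_ex_size[of ts] elim_ex_size[of "map triple_swap ts"] by (simp add: elim_var_def)
qed

lemma lit_size: "dltl_size (lit b A) \<le> 1 + dltl_size A"
  by (simp add: lit_def)

lemma unary_weight: "total_weight (unary u A) = dltl_size A + 7"
  by (simp add: unary_def total_weight_def)

lemma binary_weight: "total_weight (binary b u v R) = 12"
  by (simp add: binary_def total_weight_def)

text \<open>The left side is at most \<open>1650 * total_weight ts + 12\<close>;
  \<open>2 ^ 11 = 2048\<close> absorbs the constant since \<open>ts\<close> is nonempty.\<close>

lemma quantifier_weight:
  assumes "ts \<noteq> []"
  shows "total_weight (unary v (lit b (elim_var u ts))) \<le> 2 ^ 11 * total_weight ts"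
  using elim_var_size[of u ts] lit_size[of b "elim_var u ts"] total_weight_ge[OF assms]
  by (simp add: unary_weight)

text \<open>Connectives at most multiply the weights of their arguments and a quantifier contributes
  a constant factor, so the exponents simply add up along the formula.\<close>

lemma dnf_weight: "total_weight (dnf \<phi> b) \<le> 2 ^ (11 * fo2_size \<phi>)"
proof (induction \<phi> arbitrary: b)
  case (FLabel a u)
  show ?case using lit_size[of b "DLabel a"] by (simp add: unary_weight)
next
  case (FNot \<phi>)
  show ?case using FNot[of "\<not> b"] by (simp add: power_add)
next
  case (FAnd \<phi> \<psi>)
  have "total_weight (dnf (FAnd \<phi> \<psi>) b) \<le> total_weight (dnf \<phi> b) * total_weight (dnf \<psi> b)"
    by (auto intro!: total_weight_product total_weight_append_le dnf_nonempty)
  also have "\<dots> \<le> 2 ^ (11 * fo2_size \<phi>) * 2 ^ (11 * fo2_size \<psi>)"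
    by (intro mult_le_mono FAnd.IH)
  also have "\<dots> \<le> 2 ^ (11 * fo2_size (FAnd \<phi> \<psi>))"
    by (simp add: power_add)
  finally show ?case .
next
  case (FOr \<phi> \<psi>)
  have "total_weight (dnf (FOr \<phi> \<psi>) b) \<le> total_weight (dnf \<phi> b) * total_weight (dnf \<psi> b)"
    by (auto intro!: total_weight_product total_weight_append_le dnf_nonempty)
  also have "\<dots> \<le> 2 ^ (11 * fo2_size \<phi>) * 2 ^ (11 * fo2_size \<psi>)"
    by (intro mult_le_mono FOr.IH)
  also have "\<dots> \<le> 2 ^ (11 * fo2_size (FOr \<phi> \<psi>))"
    by (simp add: power_add)
  finally show ?case .
next
  case (FEx u \<phi>)
  have "total_weight (dnf (FEx u \<phi>) b) \<le> 2 ^ 11 * total_weight (dnf \<phi> True)"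
    unfolding dnf.simps by (rule quantifier_weight[OF dnf_nonempty])
  also have "\<dots> \<le> 2 ^ 11 * 2 ^ (11 * fo2_size \<phi>)"
    by (intro mult_le_mono FEx.IH order_refl)
  finally show ?case by (simp add: power_add)
next
  case (FAll u \<phi>)
  have "total_weight (dnf (FAll u \<phi>) b) \<le> 2 ^ 11 * total_weight (dnf \<phi> False)"
    unfolding dnf.simps by (rule quantifier_weight[OF dnf_nonempty])
  also have "\<dots> \<le> 2 ^ 11 * 2 ^ (11 * fo2_size \<phi>)"
    by (intro mult_le_mono FAll.IH order_refl)
  finally show ?case by (simp add: power_add)
qed (simp_all add: binary_weight)

section \<open>Modal depth of the normal form\<close>

fun triple_depth :: "'a triple \<Rightarrow> nat" where
  "triple_depth (A, R, B) = max (modal_depth A) (modal_depth B)"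

lemma triple_depth_and: "triple_depth (triple_and s t) = max (triple_depth s) (triple_depth t)"
  by (cases s; cases t) auto

lemma triple_depth_swap [simp]: "triple_depth (triple_swap t) = triple_depth t"
  by (cases t) auto

text \<open>The 7 levels come from \<open>diamond\<close>; disjunction adds none.\<close>

lemma elim_ex_depth:
  assumes "\<And>t. t \<in> set ts \<Longrightarrow> triple_depth t \<le> n"
  shows "modal_depth (elim_ex ts) \<le> 7 + n"
  unfolding elim_ex_def
proof (rule modal_depth_disj_le)
  fix \<phi> assume "\<phi> \<in> set (concat (map triple_diamonds ts))"
  then obtain A R B \<tau> where "(A, R, B) \<in> set ts" "\<phi> = DAnd A (diamond \<tau> B)"
    by force
  then show "modal_depth \<phi> \<le> 7 + n"
    using assms[of "(A, R, B)"] modal_depth_diamond[of \<tau> B] by simp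
qed

lemma quantifier_depth_bound:
  assumes "\<And>t. t \<in> set ts \<Longrightarrow> triple_depth t \<le> n" "t \<in> set (unary v (lit b (elim_var u ts)))"
  shows "triple_depth t \<le> 7 + n"
proof -
  have "modal_depth (elim_var u ts) \<le> 7 + n"
    unfolding elim_var_def by (rule elim_ex_depth) (use assms(1) in \<open>auto split: if_splits\<close>)
  then show ?thesis using assms(2) by (auto simp: unary_def lit_def split: if_splits)
qed

lemma dnf_depth: "t \<in> set (dnf \<phi> b) \<Longrightarrow> triple_depth t \<le> 7 * quantifier_depth \<phi>"
proof (induction \<phi> arbitrary: b t)
  case (FNot \<phi>)
  show ?case using FNot.IH[of t "\<not> b"] FNot.prems by simp
next
  case (FAnd \<phi> \<psi>)
  from FAnd.prems show ?case
    by (auto simp: triple_depth_and nat_mult_max_right le_max_iff_disj split: if_splits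
        dest!: FAnd.IH)
next
  case (FOr \<phi> \<psi>)
  from FOr.prems show ?case
    by (auto simp: triple_depth_and nat_mult_max_right le_max_iff_disj split: if_splits
        dest!: FOr.IH)
next
  case (FEx u \<phi>)
  from FEx.prems have "t \<in> set (unary (other u) (lit (b) (elim_var u (dnf \<phi> True))))" by simp
  from quantifier_depth_bound[OF FEx.IH this] show ?case by simp
next
  case (FAll u \<phi>)
  from FAll.prems have "t \<in> set (unary (other u) (lit (\<not> b) (elim_var u (dnf \<phi> False))))" by simp
  from quantifier_depth_bound[OF FAll.IH this] show ?case by simp
qed (simp_all add: unary_def lit_def binary_def)

section \<open>Formulas with one free variable\<close>

lemma fo2_sat_cong:
  "(\<And>u. u \<in> free_vars \<phi> \<Longrightarrow> \<sigma> u = \<sigma>' u) \<Longrightarrow> fo2_sat w \<sigma> \<phi> \<longleftrightarrow> fo2_sat w \<sigma>' \<phi>"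
proof (induction \<phi> arbitrary: \<sigma> \<sigma>')
  case (FNot \<phi>)
  show ?case using FNot.IH[of \<sigma> \<sigma>'] FNot.prems by simp
next
  case (FAnd \<phi> \<psi>)
  show ?case using FAnd.IH(1)[of \<sigma> \<sigma>'] FAnd.IH(2)[of \<sigma> \<sigma>'] FAnd.prems by simp
next
  case (FOr \<phi> \<psi>)
  show ?case using FOr.IH(1)[of \<sigma> \<sigma>'] FOr.IH(2)[of \<sigma> \<sigma>'] FOr.prems by simp
next
  case (FEx u \<phi>)
  have "fo2_sat w (\<sigma>(u := p)) \<phi> \<longleftrightarrow> fo2_sat w (\<sigma>'(u := p)) \<phi>" for p
    by (rule FEx.IH) (use FEx.prems in auto)
  then show ?case by simp
next
  case (FAll u \<phi>)
  have "fo2_sat w (\<sigma>(u := p)) \<phi> \<longleftrightarrow> fo2_sat w (\<sigma>'(u := p)) \<phi>" for p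
    by (rule FAll.IH) (use FAll.prems in auto)
  then show ?case by simp
qed simp_all

text \<open>
  As \<open>y\<close> is not free in the formula to be translated, it may be set to \<open>x\<close>; this avoids a final
  quantifier elimination, which would exceed modal depth 0 for quantifier-free formulas.
\<close>

definition to_dltl :: "'a fo2 \<Rightarrow> 'a dltl" where
  "to_dltl \<phi> = disj (map (\<lambda>(A, R, B). DAnd A B) (filter (\<lambda>(A, R, B). Equal \<in> R) (dnf \<phi> True)))"

lemma to_dltl_sat:
  assumes "free_vars \<phi> \<subseteq> {VX}" "\<sigma> VX \<in> positions w"
  shows "dltl_sat w (\<sigma> VX) (to_dltl \<phi>) \<longleftrightarrow> fo2_sat w \<sigma> \<phi>"
proof -
  have "dltl_sat w (\<sigma> VX) (to_dltl \<phi>) \<longleftrightarrow>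
    (\<exists>t\<in>set (dnf \<phi> True). triple_sat w (\<sigma> VX) (\<sigma> VX) t)"
  proof -
    \<comment> \<open>A position paired with itself has type \<open>Equal\<close>, which leaves the
      triples kept by the filter.\<close>
    have "triple_sat w (\<sigma> VX) (\<sigma> VX) t \<longleftrightarrow> (case t of (A, R, B) \<Rightarrow> Equal \<in> R) \<and>
      dltl_sat w (\<sigma> VX) (case t of (A, R, B) \<Rightarrow> DAnd A B)" for t
      by (cases t) (auto simp: rel_of_def)
    then show ?thesis
      by (simp only: to_dltl_def dltl_sat_disj set_map set_filter) blast
  qed
  \<comment> \<open>\<open>\<sigma> VY\<close> may lie outside the word; the constant assignment
    meets the premise of \<open>dnf_sat\<close>.\<close>
  also have "\<dots> \<longleftrightarrow> fo2_sat w (\<lambda>_. \<sigma> VX) \<phi>"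
    using dnf_sat[of "\<lambda>_. \<sigma> VX" w \<phi> True] assms(2) by simp
  also have "\<dots> \<longleftrightarrow> fo2_sat w \<sigma> \<phi>"
    by (rule fo2_sat_cong) (use assms(1) in auto)
  finally show ?thesis .
qed

text \<open>The final disjunction costs a factor \<open>2 ^ 2\<close>; as every formula has size at
  least 1, this raises the exponent from 11 to 13 per symbol.\<close>

lemma to_dltl_size: "dltl_size (to_dltl \<phi>) \<le> 2 ^ (13 * fo2_size \<phi>)"
proof -
  have "(\<Sum>\<psi>\<leftarrow>map (\<lambda>(A, R, B). DAnd A B) (filter (\<lambda>(A, R, B). Equal \<in> R) ts). dltl_size \<psi> + 4)
    \<le> 2 * total_weight ts" for ts :: "'a triple list"
  proof (induction ts)
    case (Cons t ts)
    obtain A R B where t: "t = (A, R, B)" by (cases t)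
    show ?case using Cons dltl_size_pos[of A] dltl_size_pos[of B]
      by (simp add: t total_weight_def)
  qed (simp add: total_weight_def)
  then have "dltl_size (to_dltl \<phi>) \<le> 4 + 2 * total_weight (dnf \<phi> True)"
    by (simp add: to_dltl_def dltl_size_disj)
  also have "\<dots> \<le> 2 ^ 2 * total_weight (dnf \<phi> True)"
    using total_weight_ge[OF dnf_nonempty, of \<phi> True] by simp
  also have "\<dots> \<le> 2 ^ 2 * 2 ^ (11 * fo2_size \<phi>)"
    by (intro mult_le_mono dnf_weight order_refl)
  also have "\<dots> = 2 ^ (2 + 11 * fo2_size \<phi>)"
    by (simp add: power_add)
  also have "\<dots> \<le> 2 ^ (13 * fo2_size \<phi>)"
  proof (rule power_increasing)
    have "1 \<le> fo2_size \<phi>" by (cases \<phi>) auto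
    then show "2 + 11 * fo2_size \<phi> \<le> 13 * fo2_size \<phi>" by linarith
  qed simp
  finally show ?thesis .
qed

lemma to_dltl_depth: "modal_depth (to_dltl \<phi>) \<le> 7 * quantifier_depth \<phi>"
  unfolding to_dltl_def
proof (rule modal_depth_disj_le)
  fix \<psi>
  assume "\<psi> \<in> set (map (\<lambda>(A, R, B). DAnd A B) (filter (\<lambda>(A, R, B). Equal \<in> R) (dnf \<phi> True)))"
  then obtain A R B where "(A, R, B) \<in> set (dnf \<phi> True)" "\<psi> = DAnd A B" by auto
  then show "modal_depth \<psi> \<le> 7 * quantifier_depth \<phi>" using dnf_depth[of "(A, R, B)"] by simp
qed

theorem theorem10:
  assumes "infinite (UNIV :: 'd set)"
  shows
    "(\<exists>c::nat. \<forall>\<phi> :: 'a::finite dltl. \<exists>\<phi>' :: 'a fo2.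
        free_vars \<phi>' \<subseteq> {VX} \<and>
        (\<forall>w :: ('a, 'd) data_word. \<forall>i\<in>positions w. \<forall>\<sigma>. \<sigma> VX = i \<longrightarrow>
           (dltl_sat w i \<phi> \<longleftrightarrow> fo2_sat w \<sigma> \<phi>')) \<and>
        fo2_size \<phi>' \<le> c * dltl_size \<phi> \<and>
        quantifier_depth \<phi>' = modal_depth \<phi>)
     \<and>
     (\<exists>c d :: nat. \<forall>\<phi> :: 'a fo2. free_vars \<phi> \<subseteq> {VX} \<longrightarrow>
        (\<exists>\<phi>' :: 'a dltl.
           (\<forall>w :: ('a, 'd) data_word. \<forall>i\<in>positions w. \<forall>\<sigma>. \<sigma> VX = i \<longrightarrow>
              (dltl_sat w i \<phi>' \<longleftrightarrow> fo2_sat w \<sigma> \<phi>)) \<and>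
           dltl_size \<phi>' \<le> 2 ^ (c * fo2_size \<phi>) \<and>
           modal_depth \<phi>' \<le> d * quantifier_depth \<phi>))"
proof (intro conjI)
  show "\<exists>c::nat. \<forall>\<phi> :: 'a dltl. \<exists>\<phi>' :: 'a fo2.
      free_vars \<phi>' \<subseteq> {VX} \<and>
      (\<forall>w :: ('a, 'd) data_word. \<forall>i\<in>positions w. \<forall>\<sigma>. \<sigma> VX = i \<longrightarrow>
         (dltl_sat w i \<phi> \<longleftrightarrow> fo2_sat w \<sigma> \<phi>')) \<and>
      fo2_size \<phi>' \<le> c * dltl_size \<phi> \<and>
      quantifier_depth \<phi>' = modal_depth \<phi>"
  proof (rule exI[of _ 6], rule allI, goal_cases)
    case (1 \<phi>)
    show ?case
      by (rule exI[of _ "to_fo2 VX \<phi>"])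
        (simp add: to_fo2_sat fo2_size_to_fo2 quantifier_depth_to_fo2 free_vars_to_fo2)
  qed
  show "\<exists>c d :: nat. \<forall>\<phi> :: 'a fo2. free_vars \<phi> \<subseteq> {VX} \<longrightarrow>
      (\<exists>\<phi>' :: 'a dltl.
         (\<forall>w :: ('a, 'd) data_word. \<forall>i\<in>positions w. \<forall>\<sigma>. \<sigma> VX = i \<longrightarrow>
            (dltl_sat w i \<phi>' \<longleftrightarrow> fo2_sat w \<sigma> \<phi>)) \<and>
         dltl_size \<phi>' \<le> 2 ^ (c * fo2_size \<phi>) \<and>
         modal_depth \<phi>' \<le> d * quantifier_depth \<phi>)"
  proof (rule exI[of _ 13], rule exI[of _ 7], intro allI impI, goal_cases)
    case (1 \<phi>)
    then show ?case
      by (intro exI[of _ "to_dltl \<phi>"]) (auto simp: to_dltl_sat to_dltl_size to_dltl_depth)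
  qed
qed

end
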